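(* Let $A=\bigotimes_{n\in\mathbb{N}}M_2(\mathbb{C})$ be the UHF algebra with its unique tracial state $\tau$, and let $\mathcal{M}$ be the AFD factor of type ${\rm II}_1$ obtained as the weak operator closure of the image of $A$ under the GNS representation of $\tau$, so that $A\subset\mathcal{M}$. Let $(u_n)_{n=0}^\infty$ be a sequence of self-adjoint unitaries in $A$ satisfying $$u_iu_j=(-1)^{a(|i-j|)}u_ju_i\qquad (i,j\ge 0),$$ where $a(n)\in\{0,1\}$ for $n\ge 0$ and $a(0)=0$, and suppose that for some positive integer $K$, $$a(Kl)=1\qquad (l=1,2,3,\dots).$$ Put $s_n=u_0+u_1+\cdots+u_{n-1}$. Then for every fixed $k\in\{1,2,3,\dots\}$ and every monotone increasing continuous function $\alpha:[0,1]\to[0,1]$ with $\alpha(0)=0$ and $\alpha(1)=1$, $$\lim_{n\to\infty}\Big\|\frac{s_n}{n}\Big\|=0,\qquad \lim_{n\to\infty}\Big\|\big(\tfrac{s_n}{n}\big)^k\Big\|=0,\qquad \lim_{n\to\infty}\varphi_\alpha\Big(\big(\tfrac{s_n}{n}\big)^k\Big)=0 .$$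
   Context: $\|\cdot\|$ is the operator norm. $\tau$ also denotes the normalized trace of $\mathcal{M}$. For a positive operator $b\in\mathcal{M}$, $e_{(s,\infty)}(b)$ denotes the spectral projection of $b$ for $(s,\infty)$, and $\varphi_\alpha(b):=\int_0^\infty \alpha(\tau(e_{(s,\infty)}(b)))\,ds$. For a self-adjoint $b\in\mathcal{M}$, $\varphi_\alpha(b)$ denotes the translatable extension: choose a real number $c$ with $b+cI\ge0$ and put $\varphi_\alpha(b):=\varphi_\alpha(b+cI)-c$; this does not depend on the choice of $c$ and agrees with the previous definition on positive operators. *)

theory Defs
  imports "HOL-Analysis.Analysis"
begin

section \<open>Complex Hilbert spaces and unital C*-algebras\<close>

class complex_vector = real_vector +
  fixes scaleC :: "complex \<Rightarrow> 'a \<Rightarrow> 'a"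
  assumes scaleC_add_right: "scaleC c (x + y) = scaleC c x + scaleC c y"
    and scaleC_add_left: "scaleC (c + d) x = scaleC c x + scaleC d x"
    and scaleC_scaleC: "scaleC c (scaleC d x) = scaleC (c * d) x"
    and scaleC_of_real: "scaleC (complex_of_real r) x = r *\<^sub>R x"

text \<open>The inner product is linear in the first argument.\<close>

class chilbert_space = complex_vector + banach +
  fixes cinner :: "'a \<Rightarrow> 'a \<Rightarrow> complex"
  assumes cinner_add_left: "cinner (x + y) z = cinner x z + cinner y z"
    and cinner_scaleC_left: "cinner (scaleC c x) y = c * cinner x y"
    and cinner_commute: "cinner y x = cnj (cinner x y)"
    and cinner_self: "cinner x x = complex_of_real ((norm x)\<^sup>2)"

class cstar_algebra = complex_vector + real_normed_algebra_1 + banach +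
  fixes star :: "'a \<Rightarrow> 'a"
  assumes scaleC_mult_left: "scaleC c x * y = scaleC c (x * y)"
    and scaleC_mult_right: "x * scaleC c y = scaleC c (x * y)"
    and norm_scaleC: "norm (scaleC c x) = cmod c * norm x"
    and star_star: "star (star x) = x"
    and star_add: "star (x + y) = star x + star y"
    and star_scaleC: "star (scaleC c x) = scaleC (cnj c) (star x)"
    and star_mult: "star (x * y) = star y * star x"
    and cstar_identity: "norm (star x * x) = (norm x)\<^sup>2"

definition self_adjoint_unitary :: "'a::cstar_algebra \<Rightarrow> bool" where
  "self_adjoint_unitary u \<longleftrightarrow> star u = u \<and> star u * u = 1 \<and> u * star u = 1"

definition cstar_subalgebra :: "'a::cstar_algebra set \<Rightarrow> bool" where
  "cstar_subalgebra B \<longleftrightarrow> closed B \<and> 1 \<in> B \<and>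
     (\<forall>x\<in>B. \<forall>y\<in>B. x + y \<in> B \<and> x * y \<in> B) \<and>
     (\<forall>c. \<forall>x\<in>B. scaleC c x \<in> B) \<and> (\<forall>x\<in>B. star x \<in> B)"


section \<open>The UHF algebra as an infinite tensor product\<close>

definition unital_star_hom_M2 :: "(complex^2^2 \<Rightarrow> 'a::cstar_algebra) \<Rightarrow> bool" where
  "unital_star_hom_M2 \<iota> \<longleftrightarrow> \<iota> (mat 1) = 1 \<and>
     (\<forall>x y. \<iota> (x + y) = \<iota> x + \<iota> y) \<and>
     (\<forall>c x. \<iota> (\<chi> i j. c * x $ i $ j) = scaleC c (\<iota> x)) \<and>
     (\<forall>x y. \<iota> (x ** y) = \<iota> x * \<iota> y) \<and>
     (\<forall>x. \<iota> (\<chi> i j. cnj (x $ j $ i)) = star (\<iota> x))"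

text \<open>The whole type is the infinite C*-tensor product of copies of \<open>M\<^sub>2(\<complex>)\<close>, where
  \<open>\<iota> n x\<close> is the elementary tensor \<open>1 \<otimes> \<dots> \<otimes> 1 \<otimes> x \<otimes> 1 \<otimes> \<dots>\<close> with \<open>x\<close> in position \<open>n\<close>.
  The commuting copies with indices below \<open>n\<close> induce a unital *-homomorphism of
  \<open>M\<^sub>2(\<complex>) \<otimes> \<dots> \<otimes> M\<^sub>2(\<complex>)\<close> (\<open>n\<close> factors); it is isometric because that algebra is simple
  and \<open>1 \<noteq> 0\<close>.  Together with density of the union of the ranges, this is the inductive
  limit of the finite tensor products along \<open>x \<mapsto> x \<otimes> 1\<close>.\<close>

definition infinite_tensor_M2 :: "(nat \<Rightarrow> complex^2^2 \<Rightarrow> 'a::cstar_algebra) \<Rightarrow> bool" where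
  "infinite_tensor_M2 \<iota> \<longleftrightarrow>
     (\<forall>n. unital_star_hom_M2 (\<iota> n)) \<and>
     (\<forall>m n x y. m \<noteq> n \<longrightarrow> \<iota> m x * \<iota> n y = \<iota> n y * \<iota> m x) \<and>
     (\<forall>B. cstar_subalgebra B \<longrightarrow> (\<forall>n. range (\<iota> n) \<subseteq> B) \<longrightarrow> B = UNIV)"

definition tracial_state :: "('a::cstar_algebra \<Rightarrow> complex) \<Rightarrow> bool" where
  "tracial_state \<tau> \<longleftrightarrow>
     (\<forall>x y. \<tau> (x + y) = \<tau> x + \<tau> y) \<and> (\<forall>c x. \<tau> (scaleC c x) = c * \<tau> x) \<and>
     (\<forall>x. Im (\<tau> (star x * x)) = 0 \<and> 0 \<le> Re (\<tau> (star x * x))) \<and>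
     \<tau> 1 = 1 \<and> (\<forall>x y. \<tau> (x * y) = \<tau> (y * x))"


section \<open>The GNS representation and its weak operator closure\<close>

text \<open>Elements of \<open>'h \<Rightarrow>\<^sub>L 'h\<close> are bounded real-linear maps, with the operator norm.
  Complex linearity is required where it does not already follow from a condition on
  the inner product.\<close>

definition gns_representation ::
  "('a::cstar_algebra \<Rightarrow> complex) \<Rightarrow> ('a \<Rightarrow> 'h::chilbert_space \<Rightarrow>\<^sub>L 'h) \<Rightarrow> 'h \<Rightarrow> bool" where
  "gns_representation \<tau> \<pi> \<xi> \<longleftrightarrow>
     (\<forall>a c v. \<pi> a (scaleC c v) = scaleC c (\<pi> a v)) \<and>
     (\<forall>a b. \<pi> (a + b) = \<pi> a + \<pi> b) \<and>
     (\<forall>c a v. \<pi> (scaleC c a) v = scaleC c (\<pi> a v)) \<and>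
     (\<forall>a b. \<pi> (a * b) = \<pi> a o\<^sub>L \<pi> b) \<and>
     \<pi> 1 = id_blinfun \<and>
     (\<forall>a v w. cinner (\<pi> (star a) v) w = cinner v (\<pi> a w)) \<and>
     closure (range (\<lambda>a. \<pi> a \<xi>)) = UNIV \<and>
     (\<forall>a. \<tau> a = cinner (\<pi> a \<xi>) \<xi>)"

definition weak_operator_topology :: "('h::chilbert_space \<Rightarrow>\<^sub>L 'h) topology" where
  "weak_operator_topology =
     pullback_topology UNIV (\<lambda>T (v, w). cinner (blinfun_apply T v) w) euclidean"

definition gns_von_neumann_algebra ::
  "('a::cstar_algebra \<Rightarrow> 'h::chilbert_space \<Rightarrow>\<^sub>L 'h) \<Rightarrow> ('h \<Rightarrow>\<^sub>L 'h) set" where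
  "gns_von_neumann_algebra \<pi> = weak_operator_topology closure_of (range \<pi>)"

definition positive_op :: "('h::chilbert_space \<Rightarrow>\<^sub>L 'h) \<Rightarrow> bool" where
  "positive_op T \<longleftrightarrow> (\<forall>v. Im (cinner (T v) v) = 0 \<and> 0 \<le> Re (cinner (T v) v))"

text \<open>Only the values of \<open>tr\<close> on \<open>M\<close> are constrained.  A II\<open>\<^sub>1\<close> factor has exactly one
  such functional on \<open>M\<close>; for the GNS closure it is \<open>x \<mapsto> cinner (x \<xi>) \<xi>\<close>.\<close>

definition normalized_trace ::
  "('h::chilbert_space \<Rightarrow>\<^sub>L 'h) set \<Rightarrow> (('h \<Rightarrow>\<^sub>L 'h) \<Rightarrow> complex) \<Rightarrow> bool" where
  "normalized_trace M tr \<longleftrightarrow>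
     (\<forall>S\<in>M. \<forall>T\<in>M. tr (S + T) = tr S + tr T) \<and>
     (\<forall>c. \<forall>S\<in>M. \<forall>T\<in>M. (\<forall>v. blinfun_apply T v = scaleC c (blinfun_apply S v)) \<longrightarrow> tr T = c * tr S) \<and>
     (\<forall>T\<in>M. positive_op T \<longrightarrow> Im (tr T) = 0 \<and> 0 \<le> Re (tr T)) \<and>
     tr id_blinfun = 1 \<and>
     (\<forall>S\<in>M. \<forall>T\<in>M. tr (S o\<^sub>L T) = tr (T o\<^sub>L S))"


section \<open>Spectral projections and the functional \<open>\<phi>\<^sub>\<alpha>\<close>\<close>

definition is_projection :: "('h::chilbert_space \<Rightarrow>\<^sub>L 'h) \<Rightarrow> bool" where
  "is_projection P \<longleftrightarrow> P o\<^sub>L P = P \<and> (\<forall>v w. cinner (P v) w = cinner v (P w))"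

definition projection_valued_measure ::
  "(real set \<Rightarrow> 'h::chilbert_space \<Rightarrow>\<^sub>L 'h) \<Rightarrow> bool" where
  "projection_valued_measure E \<longleftrightarrow>
     (\<forall>B\<in>sets borel. is_projection (E B)) \<and> E UNIV = id_blinfun \<and>
     (\<forall>B\<in>sets borel. \<forall>C\<in>sets borel. E (B \<inter> C) = E B o\<^sub>L E C) \<and>
     (\<forall>B::nat \<Rightarrow> real set. range B \<subseteq> sets borel \<longrightarrow> disjoint_family B \<longrightarrow>
        (\<forall>v. (\<lambda>n. E (B n) v) sums E (\<Union>n. B n) v))"

definition pvm_measure ::
  "(real set \<Rightarrow> 'h::chilbert_space \<Rightarrow>\<^sub>L 'h) \<Rightarrow> 'h \<Rightarrow> real measure" where
  "pvm_measure E v = measure_of UNIV (sets borel) (\<lambda>B. ennreal (Re (cinner (E B v) v)))"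

text \<open>\<open>b = \<integral> t dE(t)\<close>, in the sense of quadratic forms.\<close>

definition spectral_measure_of ::
  "('h::chilbert_space \<Rightarrow>\<^sub>L 'h) \<Rightarrow> (real set \<Rightarrow> 'h \<Rightarrow>\<^sub>L 'h) \<Rightarrow> bool" where
  "spectral_measure_of b E \<longleftrightarrow> projection_valued_measure E \<and>
     (\<forall>v. has_bochner_integral (pvm_measure E v) complex_of_real (cinner (b v) v))"

text \<open>By the spectral theorem \<open>E\<close> exists for self-adjoint \<open>b\<close> and is unique on Borel sets.\<close>

definition spectral_projection ::
  "('h::chilbert_space \<Rightarrow>\<^sub>L 'h) \<Rightarrow> real set \<Rightarrow> 'h \<Rightarrow>\<^sub>L 'h" where
  "spectral_projection b B = (SOME E. spectral_measure_of b E) B"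

definition phi_positive ::
  "(('h::chilbert_space \<Rightarrow>\<^sub>L 'h) \<Rightarrow> complex) \<Rightarrow> (real \<Rightarrow> real) \<Rightarrow> ('h \<Rightarrow>\<^sub>L 'h) \<Rightarrow> real" where
  "phi_positive tr \<alpha> b = (LBINT s:{0..}. \<alpha> (Re (tr (spectral_projection b {s<..}))))"

definition phi ::
  "(('h::chilbert_space \<Rightarrow>\<^sub>L 'h) \<Rightarrow> complex) \<Rightarrow> (real \<Rightarrow> real) \<Rightarrow> ('h \<Rightarrow>\<^sub>L 'h) \<Rightarrow> real" where
  "phi tr \<alpha> b = (let c = (SOME c. positive_op (b + c *\<^sub>R id_blinfun))
                 in phi_positive tr \<alpha> (b + c *\<^sub>R id_blinfun) - c)"

end

theory Submission
  imports Defs "HOL-Computational_Algebra.Fundamental_Theorem_Algebra"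
begin

text \<open>Within a residue class modulo \<open>K\<close> the \<open>u\<^sub>i\<close> anticommute pairwise, so the square of a sum of \<open>m\<close>
  of them is \<open>m\<close> and its norm is at most \<open>\<surd>m\<close>.  Adding the \<open>K\<close> classes gives
  \<open>\<parallel>s\<^sub>n\<parallel> \<le> K \<surd>n\<close>, hence the first two limits.

  For the third, \<open>\<bar>\<phi>\<^sub>\<alpha>(b)\<bar> \<le> \<parallel>b\<parallel>\<close>, because the spectral projections of \<open>b + c\<close> for \<open>(s, \<infinity>)\<close> are
  \<open>1\<close> below \<open>c - \<parallel>b\<parallel>\<close> and \<open>0\<close> above \<open>c + \<parallel>b\<parallel>\<close>.  The general spectral theorem is not needed:
  the \<open>u\<^sub>i\<close> with \<open>i < n\<close> commute up to sign and square to \<open>1\<close>, so they span a finite-dimensional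
  algebra, \<open>b = (s\<^sub>n/n)\<^sup>k\<close> satisfies a polynomial equation, and its spectral projections are
  polynomials in \<open>b\<close>.\<close>

section \<open>Hilbert space preliminaries\<close>

lemma cinner_add_right:
  fixes x :: "'h::chilbert_space"
  shows "cinner x (y + z) = cinner x y + cinner x z"
  by (metis cinner_add_left cinner_commute complex_cnj_add)

lemma cinner_scaleR_left: "cinner (r *\<^sub>R x) (y::'h::chilbert_space) = of_real r * cinner x y"
  by (metis scaleC_of_real cinner_scaleC_left)

lemma cinner_scaleR_right: "cinner (x::'h::chilbert_space) (r *\<^sub>R y) = of_real r * cinner x y"
  by (metis cinner_scaleR_left cinner_commute complex_cnj_complex_of_real complex_cnj_mult)

lemma cinner_zero_left [simp]: "cinner 0 (y::'h::chilbert_space) = 0"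
  using cinner_scaleR_left[of 0 0 y] by simp

lemma cinner_zero_right [simp]: "cinner (y::'h::chilbert_space) 0 = 0"
  using cinner_scaleR_right[of y 0 0] by simp

lemma cinner_diff_left: "cinner (x - y) (z::'h::chilbert_space) = cinner x z - cinner y z"
  using cinner_add_left[of "x - y" y z] by simp

lemma cinner_sum_left: "cinner (\<Sum>i\<in>I. f i) (y::'h::chilbert_space) = (\<Sum>i\<in>I. cinner (f i) y)"
  by (induction I rule: infinite_finite_induct) (auto simp: cinner_add_left)

lemma cinner_sum_right: "cinner (y::'h::chilbert_space) (\<Sum>i\<in>I. f i) = (\<Sum>i\<in>I. cinner y (f i))"
  by (induction I rule: infinite_finite_induct) (auto simp: cinner_add_right)

lemma Re_cinner_commute: "Re (cinner x (y::'h::chilbert_space)) = Re (cinner y x)"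
  by (metis cinner_commute complex_cnj(1) complex.exhaust_sel complex.sel(1))

lemma norm_add_squared:
  fixes v w :: "'h::chilbert_space"
  shows "(norm (v + w))\<^sup>2 = (norm v)\<^sup>2 + 2 * Re (cinner v w) + (norm w)\<^sup>2"
proof -
  have "complex_of_real ((norm (v + w))\<^sup>2)
      = of_real ((norm v)\<^sup>2) + cinner v w + cinner w v + of_real ((norm w)\<^sup>2)"
    by (simp only: cinner_self[symmetric] cinner_add_left cinner_add_right) simp
  then have "Re (complex_of_real ((norm (v + w))\<^sup>2))
      = Re (of_real ((norm v)\<^sup>2) + cinner v w + cinner w v + of_real ((norm w)\<^sup>2))"
    by (rule arg_cong)
  then show ?thesis
    using Re_cinner_commute[of v w] by simp
qed

lemma Re_cinner_le_norm: "Re (cinner v w) \<le> norm v * norm (w::'h::chilbert_space)"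
proof -
  have "(norm (v + w))\<^sup>2 \<le> (norm v + norm w)\<^sup>2"
    by (intro power_mono norm_triangle_ineq) simp
  then show ?thesis
    unfolding norm_add_squared by (simp add: power2_sum)
qed

text \<open>The operator type is only real-linear, but this identity for the complex inner product
  forces complex linearity as well.\<close>

definition symmetric_op :: "('h::chilbert_space \<Rightarrow>\<^sub>L 'h) \<Rightarrow> bool" where
  "symmetric_op T \<longleftrightarrow> (\<forall>v w. cinner (T v) w = cinner v (T w))"

lemma symmetric_opD: "symmetric_op T \<Longrightarrow> cinner (T v) w = cinner v (T w)"
  by (simp add: symmetric_op_def)

lemma symmetric_op_Im: "symmetric_op T \<Longrightarrow> Im (cinner (T v) v) = 0"
  using symmetric_opD[of T v v] cinner_commute[of "T v" v]
  by (simp add: complex_eq_iff)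

lemma symmetric_op_id: "symmetric_op id_blinfun"
  by (simp add: symmetric_op_def)

lemma symmetric_op_add: "symmetric_op S \<Longrightarrow> symmetric_op T \<Longrightarrow> symmetric_op (S + T)"
  by (simp add: symmetric_op_def blinfun.add_left cinner_add_left cinner_add_right)

lemma symmetric_op_scaleR: "symmetric_op T \<Longrightarrow> symmetric_op (r *\<^sub>R T)"
  by (simp add: symmetric_op_def blinfun.scaleR_left cinner_scaleR_left cinner_scaleR_right)

lemma symmetric_op_compose:
  "symmetric_op S \<Longrightarrow> symmetric_op T \<Longrightarrow> S o\<^sub>L T = T o\<^sub>L S \<Longrightarrow> symmetric_op (S o\<^sub>L T)"
  unfolding symmetric_op_def by (metis blinfun_apply_blinfun_compose)

lemma norm_symmetric_op_power2:
  assumes "symmetric_op S"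
  shows "cinner (S (S v)) v = of_real ((norm (S v))\<^sup>2)"
  by (simp add: symmetric_opD[OF assms] cinner_self)

text \<open>Pairing \<open>S (S v)\<close> with \<open>v\<close> gives the squared norm of
  \<open>S v\<close>. Applied to \<open>S = T - x\<close>, this lowers the multiplicity of a real
  root \<open>x\<close>.\<close>

lemma symmetric_op_square_zero:
  assumes "symmetric_op S" "S (S v) = 0"
  shows "S v = 0"
  using norm_symmetric_op_power2[OF assms(1), of v] assms(2) by simp


section \<open>Polynomials in a bounded operator\<close>

text \<open>Horner's scheme. The coefficients are real, so that polynomials in a symmetric operator
  are again symmetric.\<close>

definition op_poly :: "real poly \<Rightarrow> ('h::real_normed_vector \<Rightarrow>\<^sub>L 'h) \<Rightarrow> 'h \<Rightarrow>\<^sub>L 'h" where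
  "op_poly p T = fold_coeffs (\<lambda>c R. c *\<^sub>R id_blinfun + (T o\<^sub>L R)) p 0"

lemma blinfun_compose_zero_right: "T o\<^sub>L 0 = 0"
  by (rule blinfun_eqI) (simp add: blinfun.zero_left blinfun.zero_right)

lemma op_poly_0 [simp]: "op_poly 0 T = 0"
  by (simp add: op_poly_def)

lemma op_poly_pCons: "op_poly (pCons c p) T = c *\<^sub>R id_blinfun + (T o\<^sub>L op_poly p T)"
  by (cases "p = 0 \<and> c = 0") (auto simp: op_poly_def blinfun_compose_zero_right)

lemma op_poly_pCons_apply: "op_poly (pCons c p) T v = c *\<^sub>R v + T (op_poly p T v)"
  by (simp add: op_poly_pCons blinfun.add_left blinfun.scaleR_left)

lemma op_poly_add_apply: "op_poly (p + q) T v = op_poly p T v + op_poly q T v"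
proof (induction p arbitrary: q)
  case 0
  then show ?case by (simp add: blinfun.zero_left)
next
  case (pCons c p)
  obtain d r where q: "q = pCons d r" by (cases q)
  show ?case
    by (simp add: q op_poly_pCons_apply pCons blinfun.add_right scaleR_add_left)
qed

lemma op_poly_smult_apply: "op_poly (smult c p) T v = c *\<^sub>R op_poly p T v"
  by (induction p)
    (simp_all add: blinfun.zero_left op_poly_pCons_apply blinfun.scaleR_right scaleR_add_right)

lemma op_poly_mult_apply: "op_poly (p * q) T v = op_poly p T (op_poly q T v)"
  by (induction p)
    (simp_all add: blinfun.zero_left op_poly_pCons_apply op_poly_add_apply op_poly_smult_apply)

lemma op_poly_1_apply [simp]: "op_poly 1 T v = v"
  by (simp add: one_pCons op_poly_pCons_apply blinfun.zero_left blinfun.zero_right)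

lemma op_poly_sum_apply: "op_poly (\<Sum>i\<in>I. f i) T v = (\<Sum>i\<in>I. op_poly (f i) T v)"
  by (induction I rule: infinite_finite_induct) (simp_all add: op_poly_add_apply blinfun.zero_left)

lemma op_poly_linear_apply: "op_poly [:c, d:] T v = c *\<^sub>R v + d *\<^sub>R T v"
  by (simp add: op_poly_pCons_apply blinfun.zero_left blinfun.zero_right blinfun.scaleR_right)

lemma symmetric_op_poly:
  assumes "symmetric_op T"
  shows "symmetric_op (op_poly p T)"
proof (induction p)
  case 0
  then show ?case by (simp add: symmetric_op_def blinfun.zero_left)
next
  case (pCons c p)
  \<comment> \<open>\<open>T\<close> is \<open>op_poly [:0, 1:] T\<close>, so commutation is
    inherited from the multiplication of polynomials.\<close>
  have "T o\<^sub>L op_poly p T = op_poly p T o\<^sub>L T"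
    by (rule blinfun_eqI)
      (use op_poly_mult_apply[of "[:0, 1:]" p T] op_poly_mult_apply[of p "[:0, 1:]" T]
        in \<open>simp add: op_poly_linear_apply mult.commute\<close>)
  then show ?case
    unfolding op_poly_pCons
    by (intro symmetric_op_add symmetric_op_scaleR symmetric_op_id symmetric_op_compose assms pCons)
qed

section \<open>Real polynomials evaluated at complex points\<close>

lemma poly_map_poly_of_real_add:
  "poly (map_poly complex_of_real (p + q)) z
    = poly (map_poly complex_of_real p) z + poly (map_poly complex_of_real q) z"
  by (simp add: poly_add[symmetric] del: poly_add)
    (metis (no_types, lifting) coeff_add coeff_map_poly of_real_0 of_real_add poly_eqI)

lemma poly_map_poly_of_real_mult:
  "poly (map_poly complex_of_real (p * q)) z
    = poly (map_poly complex_of_real p) z * poly (map_poly complex_of_real q) z"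
  by (induction p)
    (simp_all add: poly_map_poly_of_real_add map_poly_pCons map_poly_smult algebra_simps)

lemma poly_map_poly_of_real_of_real:
  "poly (map_poly complex_of_real p) (of_real x) = of_real (poly p x)"
  by (induction p) (simp_all add: map_poly_pCons)

text \<open>The remainder modulo the quadratic is real of degree at most one, and such a polynomial
  vanishes at the non-real \<open>z\<close> only if it is zero.\<close>

lemma irreducible_quadratic_dvd:
  fixes p :: "real poly"
  assumes "poly (map_poly complex_of_real p) z = 0" "Im z \<noteq> 0"
  shows "[:(Re z)\<^sup>2 + (Im z)\<^sup>2, - 2 * Re z, 1:] dvd p"
proof -
  define Q where "Q = [:(Re z)\<^sup>2 + (Im z)\<^sup>2, - 2 * Re z, 1:]"
  define r where "r = p mod Q"
  have Q0: "poly (map_poly complex_of_real Q) z = 0"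
    by (simp add: Q_def complex_eq_iff power2_eq_square algebra_simps map_poly_pCons)
  have "p = p div Q * Q + r"
    by (simp add: r_def)
  then have "poly (map_poly complex_of_real (p div Q * Q + r)) z = 0"
    using assms(1) by simp
  then have r0: "poly (map_poly complex_of_real r) z = 0"
    by (simp add: Q0 poly_map_poly_of_real_add poly_map_poly_of_real_mult)
  have "degree Q = 2"
    by (simp add: Q_def)
  then have "degree r < 2"
    using degree_mod_less[of Q p] by (cases "Q = 0") (auto simp: r_def)
  then obtain c d where r: "r = [:c, d:]"
    using that[of "coeff r 0" "coeff r 1"]
    by (force intro: poly_eqI simp: coeff_pCons coeff_eq_0 split: nat.splits)
  have "c + d * Re z = 0" "d * Im z = 0"
    using r0 by (auto simp: r map_poly_pCons complex_eq_iff algebra_simps)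
  then have "r = 0"
    using assms(2) by (simp add: r)
  then show ?thesis
    by (simp add: r_def Q_def mod_eq_0_iff_dvd)
qed

text \<open>Completing the square turns the operator into \<open>(T - a)^2 + b^2\<close>. Pairing
  with \<open>v\<close> then yields a vanishing sum of the squared norms of \<open>(T - a) v\<close>
  and \<open>b v\<close>.\<close>

lemma symmetric_op_quadratic_injective:
  assumes T: "symmetric_op T" and "b \<noteq> 0"
    and 0: "op_poly [:a\<^sup>2 + b\<^sup>2, - 2 * a, 1:] T v = 0"
  shows "v = 0"
proof -
  let ?S = "op_poly [:- a, 1:] T"
  have "[:a\<^sup>2 + b\<^sup>2, - 2 * a, 1:] = [:- a, 1:] * [:- a, 1:] + [:b\<^sup>2:]"
    by (simp add: power2_eq_square)
  then have "?S (?S v) + b\<^sup>2 *\<^sub>R v = 0"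
    using 0 by (simp only: op_poly_add_apply op_poly_mult_apply op_poly_pCons_apply op_poly_0
        blinfun.zero_left blinfun.zero_right add_0_right)
  then have "cinner (?S (?S v) + b\<^sup>2 *\<^sub>R v) v = 0"
    by simp
  then have "complex_of_real ((norm (?S v))\<^sup>2 + b\<^sup>2 * (norm v)\<^sup>2) = 0"
    by (simp add: cinner_add_left cinner_scaleR_left cinner_self
        norm_symmetric_op_power2[OF symmetric_op_poly[OF T]])
  then have "(norm (?S v))\<^sup>2 + (b * norm v)\<^sup>2 = 0"
    by (simp only: of_real_eq_0_iff power_mult_distrib)
  then show ?thesis
    using \<open>b \<noteq> 0\<close> by (simp add: sum_power2_eq_zero_iff)
qed

section \<open>Reduction of an annihilating polynomial to simple real roots\<close>

abbreviation root_poly :: "real set \<Rightarrow> real poly" where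
  "root_poly \<Lambda> \<equiv> (\<Prod>x\<in>\<Lambda>. [:- x, 1:])"

text \<open>Symmetry lets one delete non-real roots and the multiplicity of real roots.\<close>

lemma symmetric_op_poly_simple_real_roots:
  assumes T: "symmetric_op T" and "p \<noteq> 0"
  shows "\<exists>\<Lambda>. finite \<Lambda> \<and> (\<forall>v. op_poly p T v = 0 \<longrightarrow> op_poly (root_poly \<Lambda>) T v = 0)"
  using \<open>p \<noteq> 0\<close>
proof (induction "degree p" arbitrary: p rule: less_induct)
  case less
  show ?case
  proof (cases "degree p = 0")
    case True
    then obtain c where "p = [:c:]" using degree_eq_zeroE by blast
    with \<open>p \<noteq> 0\<close> show ?thesis
      by (intro exI[of _ "{}"]) (auto simp: op_poly_pCons_apply blinfun.zero_left blinfun.zero_right)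
  next
    case False
    then have "degree (map_poly complex_of_real p) \<noteq> 0"
      by (simp add: degree_map_poly)
    then obtain z where z: "poly (map_poly complex_of_real p) z = 0"
      using fundamental_theorem_of_algebra[of "map_poly complex_of_real p"]
      by (auto simp: constant_degree)
    show ?thesis
    proof (cases "Im z = 0")
      case False
      obtain q where p: "p = [:(Re z)\<^sup>2 + (Im z)\<^sup>2, - 2 * Re z, 1:] * q"
        using irreducible_quadratic_dvd[OF z False] by (auto elim: dvdE)
      then have "q \<noteq> 0" using \<open>p \<noteq> 0\<close> by auto
      then have "degree q < degree p"
        unfolding p by (subst degree_mult_eq) auto
      with less.hyps[OF this \<open>q \<noteq> 0\<close>] show ?thesis
        using symmetric_op_quadratic_injective[OF T False]
        unfolding p op_poly_mult_apply by blast
    next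
      case True
      define x where "x = Re z"
      have "z = of_real x"
        using True by (simp add: x_def complex_eq_iff)
      then have "poly p x = 0"
        using z by (simp add: poly_map_poly_of_real_of_real)
      then obtain q where p: "p = [:- x, 1:] * q"
        by (auto simp: poly_eq_0_iff_dvd elim: dvdE)
      then have "q \<noteq> 0" using \<open>p \<noteq> 0\<close> by auto
      then have "degree q < degree p"
        unfolding p by (subst degree_mult_eq) auto
      from less.hyps[OF this \<open>q \<noteq> 0\<close>] obtain \<Lambda> where \<Lambda>: "finite \<Lambda>"
        "\<And>v. op_poly q T v = 0 \<Longrightarrow> op_poly (root_poly \<Lambda>) T v = 0" by blast
      \<comment> \<open>The operator \<open>T - x\<close> maps the kernel of \<open>p\<close> at
        \<open>T\<close> into the kernel of \<open>q\<close> at \<open>T\<close>, where the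
        induction hypothesis applies.\<close>
      have *: "op_poly ([:- x, 1:] * root_poly \<Lambda>) T v = 0" if "op_poly p T v = 0" for v
      proof -
        have "op_poly q T (op_poly [:- x, 1:] T v) = 0"
          using that unfolding p by (metis op_poly_mult_apply mult.commute)
        then show ?thesis
          using \<Lambda>(2) by (metis op_poly_mult_apply mult.commute)
      qed
      have "op_poly (root_poly (insert x \<Lambda>)) T v = 0" if v: "op_poly p T v = 0" for v
      proof (cases "x \<in> \<Lambda>")
        case False
        then show ?thesis using *[OF v] \<Lambda>(1) by simp
      next
        case True
        define r where "r = root_poly (\<Lambda> - {x})"
        have r: "root_poly \<Lambda> = [:- x, 1:] * r"
          unfolding r_def using \<Lambda>(1) True by (rule prod.remove)
        \<comment> \<open>Since \<open>x\<close> already lies in \<Lambda>, the new factor makes it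
          a double root; symmetry reduces the square to a single factor.\<close>
        have "op_poly [:- x, 1:] T (op_poly [:- x, 1:] T (op_poly r T v)) = 0"
          using *[OF v] unfolding r by (simp only: op_poly_mult_apply)
        then have "op_poly [:- x, 1:] T (op_poly r T v) = 0"
          by (rule symmetric_op_square_zero[OF symmetric_op_poly[OF T]])
        then show ?thesis
          using True by (simp add: r insert_absorb op_poly_mult_apply del: mult_pCons_left)
      qed
      then show ?thesis
        using \<Lambda>(1) by blast
    qed
  qed
qed

lemma root_poly_dvd:
  assumes "finite \<Lambda>" "\<And>x. x \<in> \<Lambda> \<Longrightarrow> poly p x = 0"
  shows "root_poly \<Lambda> dvd p"
  using assms
proof (induction \<Lambda> arbitrary: p rule: finite_induct)
  case (insert a \<Lambda>)
  obtain q where p: "p = [:- a, 1:] * q"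
    using insert.prems[of a] by (auto simp: poly_eq_0_iff_dvd elim: dvdE)
  have "poly q x = 0" if "x \<in> \<Lambda>" for x
    using insert.prems[of x] insert.hyps(2) that by (auto simp: p)
  then have "root_poly \<Lambda> dvd q" by (rule insert.IH)
  then show ?case
    using insert.hyps by (simp add: p del: mult_pCons_left)
qed simp

section \<open>Spectral measures\<close>

text \<open>Cauchy-Schwarz for \<open>x\<close> and \<open>- x\<close>. Boundedness carries the
  convergent series of a projection-valued measure over to quadratic forms.\<close>

lemma bounded_linear_Re_cinner: "bounded_linear (\<lambda>x. Re (cinner x (v::'h::chilbert_space)))"
proof (rule bounded_linear_intro[where K = "norm v"])
  fix x :: 'h
  have "Re (cinner (- x) v) \<le> norm (- x) * norm v"
    by (rule Re_cinner_le_norm)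
  moreover have "cinner (- x) v = - cinner x v"
    using cinner_diff_left[of 0 x v] by simp
  ultimately show "norm (Re (cinner x v)) \<le> norm x * norm v"
    using Re_cinner_le_norm[of x v] by auto
qed (auto simp: cinner_add_left cinner_scaleR_left)

lemma projection_cinner:
  assumes "is_projection P"
  shows "cinner (P v) v = of_real ((norm (P v))\<^sup>2)"
  using assms unfolding is_projection_def
  by (metis blinfun_apply_blinfun_compose cinner_self)

section \<open>Projection-valued measures and their scalar measures\<close>

context
  fixes E :: "real set \<Rightarrow> 'h::chilbert_space \<Rightarrow>\<^sub>L 'h"
  assumes E: "projection_valued_measure E"
begin

lemma pvm_projection: "B \<in> sets borel \<Longrightarrow> is_projection (E B)"
  using E by (simp add: projection_valued_measure_def)

lemma pvm_Int: "B \<in> sets borel \<Longrightarrow> C \<in> sets borel \<Longrightarrow> E B (E C v) = E (B \<inter> C) v"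
  using E by (simp add: projection_valued_measure_def)

lemma pvm_UNIV: "E UNIV v = v"
  using E by (simp add: projection_valued_measure_def)

lemma pvm_sums:
  "range B \<subseteq> sets borel \<Longrightarrow> disjoint_family B \<Longrightarrow> (\<lambda>n. E (B n) v) sums E (\<Union>n. B n) v"
  using E by (simp add: projection_valued_measure_def)

text \<open>The constant sequence of empty sets is disjoint, and a convergent series with constant
  terms has zero terms.\<close>

lemma pvm_empty: "E {} v = 0"
proof -
  have "summable (\<lambda>n::nat. E {} v)"
    using pvm_sums[of "\<lambda>_. {}" v] by (auto simp: disjoint_family_on_def summable_def)
  then show ?thesis by (simp add: summable_const_iff)
qed

lemma pvm_Compl:
  assumes "B \<in> sets borel"
  shows "E B v + E (- B) v = v"
proof -
  have "(\<lambda>n. E (binaryset B (- B) n) v) sums E (\<Union>n. binaryset B (- B) n) v"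
    using assms
    by (intro pvm_sums) (auto simp: range_binaryset_eq disjoint_family_on_def binaryset_def)
  moreover have "(\<lambda>n. E (binaryset B (- B) n) v) sums (E B v + E (- B) v)"
    by (rule binaryset_sums) (rule pvm_empty)
  ultimately show ?thesis
    using sums_unique2 pvm_UNIV by (fastforce simp: UN_binaryset_eq)
qed

lemma space_pvm_measure [simp]: "space (pvm_measure E v) = UNIV"
  by (simp add: pvm_measure_def)

lemma sets_pvm_measure [simp, measurable_cong]: "sets (pvm_measure E v) = sets borel"
  using sets.sets_measure_of_eq[of "borel :: real measure"] by (simp add: pvm_measure_def)

text \<open>\<open>measure_of\<close> takes the prescribed values once countable additivity is
  established; this comes from the pointwise summability of \<open>E\<close>.\<close>

lemma emeasure_pvm_measure:
  assumes "B \<in> sets borel"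
  shows "emeasure (pvm_measure E v) B = ennreal ((norm (E B v))\<^sup>2)"
proof -
  have "emeasure (pvm_measure E v) B = ennreal (Re (cinner (E B v) v))"
    unfolding pvm_measure_def
  proof (rule emeasure_measure_of_sigma)
    show "sigma_algebra UNIV (sets borel :: real set set)"
      using sets.sigma_algebra_axioms[of "borel :: real measure"] by simp
    show "positive (sets borel) (\<lambda>B. ennreal (Re (cinner (E B v) v)))"
      by (simp add: positive_def pvm_empty)
    show "countably_additive (sets borel) (\<lambda>B. ennreal (Re (cinner (E B v) v)))"
    proof (rule countably_additiveI)
      fix A :: "nat \<Rightarrow> real set"
      assume A: "range A \<subseteq> sets borel" "disjoint_family A"
      have "(\<lambda>i. Re (cinner (E (A i) v) v)) sums Re (cinner (E (\<Union>i. A i) v) v)"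
        by (rule bounded_linear.sums[OF bounded_linear_Re_cinner pvm_sums[OF A]])
      moreover have "0 \<le> Re (cinner (E (A i) v) v)" for i
        using A(1) by (subst projection_cinner[OF pvm_projection]) auto
      ultimately show "(\<Sum>i. ennreal (Re (cinner (E (A i) v) v)))
          = ennreal (Re (cinner (E (\<Union>i. A i) v) v))"
        by (intro suminf_ennreal_eq)
    qed
  qed (fact assms)
  then show ?thesis
    by (simp add: projection_cinner[OF pvm_projection[OF assms]])
qed

lemma finite_measure_pvm_measure: "finite_measure (pvm_measure E v)"
  by (rule finite_measureI) (simp add: emeasure_pvm_measure)

lemma measure_pvm_measure:
  "B \<in> sets borel \<Longrightarrow> measure (pvm_measure E v) B = (norm (E B v))\<^sup>2"
  by (simp add: measure_def emeasure_pvm_measure)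

text \<open>Both sides give \<open>A\<close> the squared norm of \<open>E (A \<inter> B) v\<close>.
  Quadratic forms at \<open>E B v\<close> thereby become integrals over \<open>B\<close> against the
  measure of \<open>v\<close>.\<close>

lemma pvm_measure_restrict:
  assumes B: "B \<in> sets borel"
  shows "pvm_measure E (E B v) = density (pvm_measure E v) (\<lambda>x. ennreal (indicator B x))"
proof (rule measure_eqI)
  fix A assume "A \<in> sets (pvm_measure E (E B v))"
  then have A: "A \<in> sets borel" by simp
  have "emeasure (density (pvm_measure E v) (indicator B)) A = emeasure (pvm_measure E v) (B \<inter> A)"
    using A B by (intro emeasure_restricted) auto
  also have "\<dots> = emeasure (pvm_measure E (E B v)) A"
    using A B by (simp add: emeasure_pvm_measure pvm_Int Int_commute)
  finally show "emeasure (pvm_measure E (E B v)) A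
      = emeasure (density (pvm_measure E v) (\<lambda>x. ennreal (indicator B x))) A"
    by (simp add: ennreal_indicator)
qed simp

end

section \<open>The action of a spectral measure on eigenvectors\<close>

lemma spectral_measure_of_pvm: "spectral_measure_of T E \<Longrightarrow> projection_valued_measure E"
  by (simp add: spectral_measure_of_def)

lemma spectral_measure_of_integral:
  assumes "spectral_measure_of T E"
  shows "has_bochner_integral (pvm_measure E v) (\<lambda>x. x) (Re (cinner (T v) v))"
proof -
  have "has_bochner_integral (pvm_measure E v) complex_of_real (cinner (T v) v)"
    using assms by (simp add: spectral_measure_of_def)
  from has_bochner_integral_bounded_linear[OF bounded_linear_Re this] show ?thesis
    by simp
qed

text \<open>The restricted measures of \<open>E B v\<close> and \<open>E (- B) v\<close> add up to that of \<open>v\<close>, hence so do the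
  quadratic forms, and the mixed term vanishes.\<close>

lemma spectral_measure_of_reduces:
  assumes TE: "spectral_measure_of T E" and T: "symmetric_op T" and B: "B \<in> sets borel"
  shows "Re (cinner (T (E (- B) v)) (E B v)) = 0"
proof -
  note E = spectral_measure_of_pvm[OF TE]
  let ?M = "pvm_measure E v" and ?w = "E B v" and ?w' = "E (- B) v"
  have id: "integrable ?M (\<lambda>x. x)" and id': "integral\<^sup>L ?M (\<lambda>x. x) = Re (cinner (T v) v)"
    using spectral_measure_of_integral[OF TE, of v] by (auto simp: has_bochner_integral_iff)
  have form: "Re (cinner (T (E C v)) (E C v)) = (\<integral>x. indicator C x *\<^sub>R x \<partial>?M)"
    and int: "integrable ?M (\<lambda>x. indicator C x *\<^sub>R x)" if C: "C \<in> sets borel" for C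
  proof -
    have "Re (cinner (T (E C v)) (E C v)) = integral\<^sup>L (pvm_measure E (E C v)) (\<lambda>x. x)"
      using spectral_measure_of_integral[OF TE] by (auto simp: has_bochner_integral_iff)
    also have "\<dots> = (\<integral>x. indicator C x *\<^sub>R x \<partial>?M)"
      unfolding pvm_measure_restrict[OF E C]
      using C
      by (intro integral_density) (auto simp: measurable_cong_sets[OF sets_pvm_measure[OF E] refl])
    finally show "Re (cinner (T (E C v)) (E C v)) = (\<integral>x. indicator C x *\<^sub>R x \<partial>?M)" .
    show "integrable ?M (\<lambda>x. indicator C x *\<^sub>R x)"
      using C id by (intro integrable_mult_indicator) (simp_all add: sets_pvm_measure[OF E])
  qed
  have "Re (cinner (T ?w) ?w) + Re (cinner (T ?w') ?w')
      = (\<integral>x. indicator B x *\<^sub>R x + indicator (- B) x *\<^sub>R x \<partial>?M)"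
    using B by (simp only: form int borel_comp Bochner_Integration.integral_add)
  also have "\<dots> = Re (cinner (T v) v)"
    unfolding id'[symmetric]
    by (intro Bochner_Integration.integral_cong) (auto simp: indicator_def)
  also have "\<dots> = Re (cinner (T (?w + ?w')) (?w + ?w'))"
    by (simp only: pvm_Compl[OF E B])
  also have "\<dots> = Re (cinner (T ?w) ?w) + Re (cinner (T ?w') ?w')
      + Re (cinner (T ?w) ?w') + Re (cinner (T ?w') ?w)"
    by (simp add: blinfun.add_right cinner_add_left cinner_add_right)
  \<comment> \<open>The two mixed terms have equal real parts by symmetry of \<open>T\<close>; their
    sum is zero, hence so is each.\<close>
  finally show ?thesis
    using Re_cinner_commute[of "T ?w" ?w'] by (simp add: symmetric_opD[OF T])
qed

text \<open>For \<open>w = E B v\<close> the mixed term drops out, so the quadratic form of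
  \<open>T\<close> at \<open>w\<close> is \<open>x\<close> times the squared norm of
  \<open>w\<close>. Thus \<open>t - x\<close> has integral zero against the measure of
  \<open>w\<close>, which is concentrated on \<open>B\<close>, where \<open>s * (t - x)\<close> is
  positive. The measure must be zero. The factor \<open>s\<close> treats both sides of
  \<open>x\<close> at once.\<close>

lemma spectral_measure_of_eigenvector_vanish:
  assumes TE: "spectral_measure_of T E" and T: "symmetric_op T" and B: "B \<in> sets borel"
    and v: "T v = x *\<^sub>R v" and s: "\<And>t. t \<in> B \<Longrightarrow> s * (t - x) > 0"
  shows "E B v = 0"
proof -
  note E = spectral_measure_of_pvm[OF TE]
  let ?w = "E B v"
  let ?M = "pvm_measure E ?w"
  interpret finite_measure ?M
    by (rule finite_measure_pvm_measure[OF E])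
  have "Re (cinner (T v) ?w) = Re (cinner (T ?w) ?w) + Re (cinner (T (E (- B) v)) ?w)"
    by (subst pvm_Compl[OF E B, of v, symmetric]) (simp add: blinfun.add_right cinner_add_left)
  then have "Re (cinner (T ?w) ?w) = x * Re (cinner v ?w)"
    by (simp add: spectral_measure_of_reduces[OF TE T B] v cinner_scaleR_left)
  also have "Re (cinner v ?w) = (norm ?w)\<^sup>2"
    by (subst Re_cinner_commute) (simp add: projection_cinner[OF pvm_projection[OF E B]])
  finally have Tw: "Re (cinner (T ?w) ?w) = x * (norm ?w)\<^sup>2" .
  have id: "integrable ?M (\<lambda>t. t)" "integral\<^sup>L ?M (\<lambda>t. t) = x * (norm ?w)\<^sup>2"
    using spectral_measure_of_integral[OF TE, of ?w] by (auto simp: has_bochner_integral_iff Tw)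
  have "(\<integral>t. s * (t - x) \<partial>?M) = s * (x * (norm ?w)\<^sup>2 - x * measure ?M UNIV)"
    using id by (simp add: space_pvm_measure[OF E])
  also have "\<dots> = 0"
    by (simp add: measure_pvm_measure[OF E] pvm_UNIV[OF E])
  finally have 0: "(\<integral>t. s * (t - x) \<partial>?M) = 0" .
  have "AE t in ?M. t \<in> B"
  proof (rule AE_I)
    show "{t \<in> space ?M. t \<notin> B} \<subseteq> - B" by auto
    show "emeasure ?M (- B) = 0"
      using B by (simp add: emeasure_pvm_measure[OF E] pvm_Int[OF E] pvm_empty[OF E])
    show "- B \<in> sets ?M" using B by (simp add: sets_pvm_measure[OF E])
  qed
  then have pos: "AE t in ?M. 0 < s * (t - x)"
    by eventually_elim (rule s)
  have "AE t in ?M. s * (t - x) = 0"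
  proof (rule integral_nonneg_eq_0_iff_AE[THEN iffD1, OF _ _ 0])
    show "integrable ?M (\<lambda>t. s * (t - x))"
      using id(1) by simp
    show "AE t in ?M. 0 \<le> s * (t - x)"
      using pos by eventually_elim simp
  qed
  with pos have "AE t in ?M. False"
    by eventually_elim simp
  then obtain N where "space ?M \<subseteq> N" "emeasure ?M N = 0"
    by (rule AE_E) auto
  then have "emeasure ?M UNIV = 0"
    by (simp add: space_pvm_measure[OF E] top.extremum_unique)
  then show ?thesis
    by (simp add: emeasure_pvm_measure[OF E] pvm_UNIV[OF E])
qed

text \<open>Both open half-lines at \<open>x\<close> annihilate \<open>v\<close>, so all of
  \<open>v\<close> sits at the point \<open>x\<close>. This determines \<open>E\<close> on
  eigenvectors and is the source of uniqueness.\<close>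

lemma spectral_measure_of_eigenvector:
  assumes TE: "spectral_measure_of T E" and T: "symmetric_op T" and B: "B \<in> sets borel"
    and v: "T v = x *\<^sub>R v"
  shows "E B v = (if x \<in> B then v else 0)"
proof -
  note E = spectral_measure_of_pvm[OF TE]
  have "E {x<..} v = 0" "E {..<x} v = 0"
    using spectral_measure_of_eigenvector_vanish[OF TE T _ v, of "{x<..}" 1]
      spectral_measure_of_eigenvector_vanish[OF TE T _ v, of "{..<x}" "-1"] by auto
  then have "E {..x} v = v" "E {x..} v = v"
    using pvm_Compl[OF E, of "{x<..}" v] pvm_Compl[OF E, of "{..<x}" v] by simp_all
  then have *: "E {x} v = v"
    using pvm_Int[OF E, of "{x..}" "{..x}" v] by (simp flip: atLeastAtMost_def)
  then have "E B v = E (B \<inter> {x}) v"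
    using pvm_Int[OF E B, of "{x}" v] by simp
  then show ?thesis
    using * by (auto simp: pvm_empty[OF E] Int_insert_right)
qed


section \<open>Finite spectral resolutions\<close>

text \<open>\<open>T\<close> is diagonal with finitely many real eigenvalues, and \<open>P x\<close>
  is the orthogonal projection onto the eigenspace of \<open>x\<close>. By \<open>P_nonzero\<close>
  every point of \<Lambda> is a genuine eigenvalue, hence bounded by the norm of
  \<open>T\<close>.\<close>

locale finite_spectral_resolution =
  fixes T :: "'h::chilbert_space \<Rightarrow>\<^sub>L 'h" and \<Lambda> :: "real set" and P :: "real \<Rightarrow> 'h \<Rightarrow>\<^sub>L 'h"
  assumes finite_spectrum: "finite \<Lambda>"
    and P_nonzero: "x \<in> \<Lambda> \<Longrightarrow> P x \<noteq> 0"
    and P_symmetric: "x \<in> \<Lambda> \<Longrightarrow> symmetric_op (P x)"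
    and P_P: "x \<in> \<Lambda> \<Longrightarrow> y \<in> \<Lambda> \<Longrightarrow> P x (P y v) = (if x = y then P x v else 0)"
    and P_sum: "(\<Sum>x\<in>\<Lambda>. P x v) = v"
    and T_P: "x \<in> \<Lambda> \<Longrightarrow> T (P x v) = x *\<^sub>R P x v"
begin

definition proj :: "real set \<Rightarrow> 'h \<Rightarrow>\<^sub>L 'h" where
  "proj B = (\<Sum>x\<in>\<Lambda> \<inter> B. P x)"

lemma proj_apply: "proj B v = (\<Sum>x\<in>\<Lambda> \<inter> B. P x v)"
  by (simp add: proj_def blinfun.sum_left)

lemma proj_P:
  assumes "y \<in> \<Lambda>"
  shows "proj B (P y v) = (if y \<in> B then P y v else 0)"
proof -
  have "proj B (P y v) = (\<Sum>x\<in>\<Lambda> \<inter> B. if x = y then P y v else 0)"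
    using assms by (auto simp: proj_apply P_P intro!: sum.cong)
  then show ?thesis
    using assms finite_spectrum by simp
qed

lemma proj_Int: "proj B (proj C v) = proj (B \<inter> C) v"
proof -
  have "proj B (proj C v) = (\<Sum>x\<in>\<Lambda> \<inter> C. if x \<in> B then P x v else 0)"
    unfolding proj_apply[of C] blinfun.sum_right by (intro sum.cong) (auto simp: proj_P)
  also have "\<dots> = proj (B \<inter> C) v"
    using finite_spectrum
    by (simp add: proj_apply flip: sum.inter_filter) (rule sum.cong, auto)
  finally show ?thesis .
qed

lemma proj_Un:
  "B \<inter> C = {} \<Longrightarrow> proj (B \<union> C) = proj B + proj C"
  unfolding proj_def Int_Un_distrib using finite_spectrum by (intro sum.union_disjoint) auto

lemma proj_full: "\<Lambda> \<subseteq> B \<Longrightarrow> proj B = id_blinfun"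
  by (rule blinfun_eqI) (simp add: proj_apply P_sum Int_absorb2)

lemma proj_disjoint: "\<Lambda> \<inter> B = {} \<Longrightarrow> proj B = 0"
  by (simp add: proj_def)

lemma proj_symmetric: "symmetric_op (proj B)"
  unfolding symmetric_op_def
  by (auto simp: proj_apply cinner_sum_left cinner_sum_right symmetric_opD[OF P_symmetric])

lemma proj_projection: "is_projection (proj B)"
  unfolding is_projection_def using proj_symmetric proj_Int
  by (auto simp: symmetric_op_def intro: blinfun_eqI)

lemma proj_positive: "positive_op (proj B)"
  by (simp add: positive_op_def projection_cinner[OF proj_projection])

lemma T_eq: "T v = (\<Sum>x\<in>\<Lambda>. x *\<^sub>R P x v)"
  by (subst P_sum[of v, symmetric]) (simp add: blinfun.sum_right T_P)

lemma T_symmetric: "symmetric_op T"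
  unfolding symmetric_op_def
  by (auto simp: T_eq cinner_sum_left cinner_sum_right cinner_scaleR_left cinner_scaleR_right
      symmetric_opD[OF P_symmetric])

text \<open>Each point of \<Lambda> lies in at most one member of a disjoint family, so only
  finitely many members contribute and the series is a finite sum.\<close>

lemma proj_pvm: "projection_valued_measure proj"
  unfolding projection_valued_measure_def
proof (intro conjI ballI allI impI)
  show "proj UNIV = id_blinfun"
    by (rule proj_full) simp
  show "proj (B \<inter> C) = proj B o\<^sub>L proj C" for B C
    by (rule blinfun_eqI) (simp add: proj_Int)
  fix B :: "nat \<Rightarrow> real set" and v
  assume B: "disjoint_family B"
  define N where "N = {n. \<Lambda> \<inter> B n \<noteq> {}}"
  have "finite {n. x \<in> B n}" for x
  proof (cases "\<exists>m. x \<in> B m")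
    case True
    then obtain m where "x \<in> B m" ..
    with B have "{n. x \<in> B n} = {m}"
      by (auto simp: disjoint_family_on_def)
    then show ?thesis by simp
  qed simp
  then have "finite (\<Union>x\<in>\<Lambda>. {n. x \<in> B n})"
    using finite_spectrum by blast
  moreover have "(\<Union>x\<in>\<Lambda>. {n. x \<in> B n}) = N"
    by (auto simp: N_def)
  ultimately have N: "finite N" by simp
  have "proj (\<Union>n. B n) v = (\<Sum>x\<in>(\<Union>n\<in>N. \<Lambda> \<inter> B n). P x v)"
    unfolding proj_apply by (rule sum.cong) (auto simp: N_def)
  also have "\<dots> = (\<Sum>n\<in>N. proj (B n) v)"
    unfolding proj_apply
    using N finite_spectrum B by (intro sum.UNION_disjoint) (auto simp: disjoint_family_on_def)
  finally show "(\<lambda>n. proj (B n) v) sums proj (\<Union>n. B n) v"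
    using N by (auto intro!: sums_finite simp: N_def proj_disjoint blinfun.zero_left)
qed (rule proj_projection)

text \<open>The scalar measure is carried by \<Lambda>, so almost everywhere the identity function
  equals a simple function whose integral is a finite sum.\<close>

lemma proj_spectral_measure: "spectral_measure_of T proj"
  unfolding spectral_measure_of_def
proof (intro conjI allI proj_pvm)
  fix v
  let ?M = "pvm_measure proj v"
  note sets = sets_pvm_measure[OF proj_pvm]
  interpret finite_measure ?M
    by (rule finite_measure_pvm_measure[OF proj_pvm])
  have meas: "measure ?M {x} *\<^sub>R complex_of_real x = of_real x * cinner (P x v) v" if "x \<in> \<Lambda>" for x
  proof -
    have "proj {x} v = P x v"
      using that by (simp add: proj_apply Int_insert_right)
    then show ?thesis
      using projection_cinner[OF proj_projection, of "{x}" v]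
      by (simp add: measure_pvm_measure[OF proj_pvm] scaleR_conv_of_real)
  qed
  have "has_bochner_integral ?M (\<lambda>t. \<Sum>x\<in>\<Lambda>. indicator {x} t *\<^sub>R complex_of_real x)
      (\<Sum>x\<in>\<Lambda>. measure ?M {x} *\<^sub>R complex_of_real x)"
    by (intro has_bochner_integral_sum has_bochner_integral_indicator)
      (auto simp: sets less_top[symmetric])
  also have "(\<Sum>x\<in>\<Lambda>. measure ?M {x} *\<^sub>R complex_of_real x) = cinner (T v) v"
    by (simp add: meas T_eq cinner_sum_left cinner_scaleR_left)
  finally show "has_bochner_integral ?M complex_of_real (cinner (T v) v)"
  proof (rule has_bochner_integralI_AE)
    show "complex_of_real \<in> borel_measurable ?M"
      by (simp add: measurable_cong_sets[OF sets refl])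
    have "AE t in ?M. t \<in> \<Lambda>"
    proof (rule AE_I)
      show "{t \<in> space ?M. t \<notin> \<Lambda>} \<subseteq> - \<Lambda>" by auto
      have "- \<Lambda> \<in> sets borel"
        by (intro borel_comp borel_closed finite_imp_closed finite_spectrum)
      then show "emeasure ?M (- \<Lambda>) = 0" "- \<Lambda> \<in> sets ?M"
        by (simp_all add: sets emeasure_pvm_measure[OF proj_pvm] proj_disjoint blinfun.zero_left)
    qed
    then show "AE t in ?M. (\<Sum>x\<in>\<Lambda>. indicator {x} t *\<^sub>R complex_of_real x) = complex_of_real t"
    proof eventually_elim
      case (elim t)
      have "(\<Sum>x\<in>\<Lambda>. indicator {x} t *\<^sub>R complex_of_real x)
          = (\<Sum>x\<in>\<Lambda>. if x = t then complex_of_real t else 0)"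
        by (intro sum.cong) (auto simp: indicator_def)
      then show ?case
        using elim finite_spectrum by simp
    qed
  qed
qed

text \<open>Every vector is a sum of the eigenvectors \<open>P x v\<close>, on which
  \<open>E B\<close> is already determined.\<close>

lemma spectral_measure_unique:
  assumes "spectral_measure_of T E" "B \<in> sets borel"
  shows "E B = proj B"
proof (rule blinfun_eqI)
  fix v
  have "E B v = (\<Sum>x\<in>\<Lambda>. E B (P x v))"
    by (subst P_sum[of v, symmetric]) (simp add: blinfun.sum_right)
  also have "\<dots> = (\<Sum>x\<in>\<Lambda>. if x \<in> B then P x v else 0)"
    by (intro sum.cong refl spectral_measure_of_eigenvector[OF assms(1) T_symmetric assms(2)] T_P)
  also have "\<dots> = proj B v"
    using finite_spectrum by (simp add: proj_apply sum.inter_restrict)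
  finally show "E B v = proj B v" .
qed

text \<open>The definition makes an arbitrary choice; existence and uniqueness together fix its
  value on Borel sets.\<close>

lemma spectral_projection_eq: "B \<in> sets borel \<Longrightarrow> spectral_projection T B = proj B"
  unfolding spectral_projection_def
  by (rule spectral_measure_unique[OF someI[of "spectral_measure_of T"]])
    (rule proj_spectral_measure)

lemma eigenvector:
  assumes "x \<in> \<Lambda>"
  obtains v where "v \<noteq> 0" "T v = x *\<^sub>R v"
proof -
  obtain w where "P x w \<noteq> 0"
    using P_nonzero[OF assms] by (metis blinfun_eqI blinfun.zero_left)
  then show ?thesis
    using that T_P[OF assms] by blast
qed

lemma abs_eigenvalue_le_norm:
  assumes "x \<in> \<Lambda>"
  shows "\<bar>x\<bar> \<le> norm T"
proof -
  obtain v where v: "v \<noteq> 0" "T v = x *\<^sub>R v"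
    using eigenvector[OF assms] .
  then have "\<bar>x\<bar> * norm v \<le> norm T * norm v"
    using norm_blinfun[of T v] by simp
  then show ?thesis using v(1) by simp
qed

text \<open>Needed because \<open>phi\<close> is evaluated at a translate: the eigenspaces stay and
  the eigenvalues move by \<open>c\<close>.\<close>

lemma shift:
  "finite_spectral_resolution (T + c *\<^sub>R id_blinfun) ((\<lambda>x. x + c) ` \<Lambda>) (\<lambda>x. P (x - c))"
proof
  show "(\<Sum>x\<in>(\<lambda>x. x + c) ` \<Lambda>. P (x - c) v) = v" for v
    by (subst sum.reindex) (auto simp: P_sum)
qed (auto simp: finite_spectrum P_nonzero P_symmetric P_P T_P blinfun.add_left blinfun.scaleR_left
    scaleR_add_left)

end

text \<open>The projections are the Lagrange interpolation polynomials of the simple real roots,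
  evaluated at \<open>T\<close>. Their being polynomials in \<open>T\<close> later places them in
  the von Neumann algebra.\<close>

lemma symmetric_op_finite_spectral_resolution:
  assumes T: "symmetric_op T" and "p \<noteq> 0" "op_poly p T = 0"
  obtains \<Lambda> P where "finite_spectral_resolution T \<Lambda> P" "\<And>x. x \<in> \<Lambda> \<Longrightarrow> \<exists>q. P x = op_poly q T"
proof -
  obtain S where S: "finite S" "\<And>v. op_poly (root_poly S) T v = 0"
    using symmetric_op_poly_simple_real_roots[OF T \<open>p \<noteq> 0\<close>] assms(3)
    by (auto simp: blinfun.zero_left)
  have vanish: "op_poly q T v = 0" if q: "\<And>x. x \<in> S \<Longrightarrow> poly q x = 0" for q v
  proof -
    obtain r where "q = root_poly S * r"
      using root_poly_dvd[OF S(1) q] by (auto elim: dvdE)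
    then show ?thesis by (simp add: op_poly_mult_apply S(2))
  qed
  \<comment> \<open>All identities between polynomials in \<open>T\<close> thus reduce to a check at
    the points of \<open>S\<close>.\<close>
  have eqI: "op_poly q T v = op_poly r T v" if "\<And>x. x \<in> S \<Longrightarrow> poly q x = poly r x" for q r v
  proof -
    have "op_poly q T v = op_poly (q - r) T v + op_poly r T v"
      by (simp flip: op_poly_add_apply)
    then show ?thesis using vanish[of "q - r"] that by simp
  qed
  define l where "l x = (\<Prod>y\<in>S - {x}. smult (1 / (x - y)) [:- y, 1:])" for x
  have l: "poly (l x) y = (if x = y then 1 else 0)" if "x \<in> S" "y \<in> S" for x y
    unfolding l_def poly_prod using S(1) that by (auto intro!: prod.neutral simp flip: diff_divide_distrib)
  define P where "P x = op_poly (l x) T" for x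
  \<comment> \<open>A root need not be an eigenvalue; those with zero projection are
    discarded.\<close>
  define \<Lambda> where "\<Lambda> = {x \<in> S. P x \<noteq> 0}"
  have "finite_spectral_resolution T \<Lambda> P"
  proof
    show "finite \<Lambda>" using S(1) by (simp add: \<Lambda>_def)
    show "P x \<noteq> 0" if "x \<in> \<Lambda>" for x using that by (simp add: \<Lambda>_def)
    show "symmetric_op (P x)" for x unfolding P_def by (rule symmetric_op_poly[OF T])
    show "P x (P y v) = (if x = y then P x v else 0)" if "x \<in> \<Lambda>" "y \<in> \<Lambda>" for x y v
    proof -
      have "P x (P y v) = op_poly (if x = y then l x else 0) T v"
        unfolding P_def op_poly_mult_apply[symmetric]
        using that by (intro eqI) (auto simp: l \<Lambda>_def)
      then show ?thesis by (simp add: P_def blinfun.zero_left)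
    qed
    show "T (P x v) = x *\<^sub>R P x v" if "x \<in> \<Lambda>" for x v
    proof -
      have "op_poly ([:0, 1:] * l x) T v = op_poly (smult x (l x)) T v"
        using that by (intro eqI) (auto simp: l \<Lambda>_def)
      then show ?thesis
        by (simp only: op_poly_mult_apply op_poly_linear_apply op_poly_smult_apply P_def) simp
    qed
    show "(\<Sum>x\<in>\<Lambda>. P x v) = v" for v
    proof -
      have "(\<Sum>x\<in>\<Lambda>. P x v) = (\<Sum>x\<in>S. P x v)"
        using S(1) by (intro sum.mono_neutral_left) (auto simp: \<Lambda>_def blinfun.zero_left)
      also have "\<dots> = op_poly (\<Sum>x\<in>S. l x) T v"
        by (simp add: P_def op_poly_sum_apply)
      also have "\<dots> = op_poly 1 T v"
        using S(1) by (intro eqI) (simp add: poly_sum l)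
      finally show ?thesis by simp
    qed
  qed
  then show ?thesis
    using that P_def by blast
qed

section \<open>The functional \<open>\<phi>\<^sub>\<alpha>\<close>\<close>

context finite_spectral_resolution
begin

text \<open>The integrand takes values between 0 and 1, equals 1 below \<open>lo\<close> and 0 from
  \<open>hi\<close> on. On the positive half-line it therefore lies between the indicators of
  \<open>{0..<lo}\<close> and \<open>{0..hi}\<close>.\<close>

lemma phi_positive_bounds:
  assumes tr: "normalized_trace M tr"
    and M: "\<And>B. proj B \<in> M"
    and mono: "mono_on {0..1} \<alpha>" and \<alpha>01: "\<alpha> 0 = 0" "\<alpha> 1 = 1"
    and \<Lambda>: "\<And>x. x \<in> \<Lambda> \<Longrightarrow> lo \<le> x \<and> x \<le> hi" and "0 \<le> hi"
  shows "lo \<le> phi_positive tr \<alpha> T" "phi_positive tr \<alpha> T \<le> hi"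
proof -
  define d where "d B = Re (tr (proj B))" for B
  define g where "g s = \<alpha> (d {s<..})" for s
  have d_Un: "d (B \<union> C) = d B + d C" if "B \<inter> C = {}" for B C
    using tr M unfolding d_def proj_Un[OF that] normalized_trace_def by simp
  have d_nonneg: "0 \<le> d B" for B
    using tr M proj_positive unfolding d_def normalized_trace_def by blast
  have d_mono: "d B \<le> d C" if "B \<subseteq> C" for B C
    using d_Un[of B "C - B"] d_nonneg[of "C - B"] that by (simp add: Un_absorb1)
  have d_full: "d B = 1" if "\<Lambda> \<subseteq> B" for B
    using tr by (simp add: d_def proj_full[OF that] normalized_trace_def)
  have d_empty: "d B = 0" if "\<Lambda> \<inter> B = {}" for B
    using that d_Un[of "{}" "{}"] by (simp add: d_def proj_disjoint)
  have d_le: "d B \<le> 1" for B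
    using d_mono[of B UNIV] d_full[of UNIV] by simp
  have g_antimono: "g t \<le> g s" if "s \<le> t" for s t
    unfolding g_def using that
    by (intro mono_onD[OF mono] d_mono) (auto simp: d_nonneg d_le)
  have g01: "0 \<le> g s" "g s \<le> 1" for s
    using mono_onD[OF mono, of 0 "d {s<..}"] mono_onD[OF mono, of "d {s<..}" 1] \<alpha>01
      d_nonneg[of "{s<..}"] d_le[of "{s<..}"] by (auto simp: g_def)
  have g_lo: "g s = 1" if "s < lo" for s
    unfolding g_def using \<Lambda> that by (subst d_full) (fastforce simp: \<alpha>01)+
  have g_hi: "g s = 0" if "hi \<le> s" for s
    unfolding g_def using \<Lambda> that by (subst d_empty) (fastforce simp: \<alpha>01)+
  \<comment> \<open>Measurability comes from monotonicity: the trace of the projection decreases in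
    \<open>s\<close> and \<alpha> is increasing.\<close>
  have "mono (\<lambda>s. - g s)"
    by (auto intro!: monoI g_antimono)
  then have "(\<lambda>s. - (- g s)) \<in> borel_measurable borel"
    by (intro borel_measurable_uminus borel_measurable_mono)
  then have g_meas [measurable]: "g \<in> borel_measurable borel"
    by simp
  have upper: "indicator {0..} s * g s \<le> indicator {0..hi} s" for s
    using g01[of s] g_hi[of s] by (auto simp: indicator_def)
  have lower: "indicator {0..<lo} s \<le> indicator {0..} s * g s" for s
    using g01[of s] g_lo[of s] by (auto simp: indicator_def)
  have int_hi: "integrable lborel (indicator {0..hi} :: real \<Rightarrow> real)"
    by (rule integrable_real_indicator) (auto simp: emeasure_lborel_Icc_eq)
  have int_lo: "integrable lborel (indicator {0..<lo} :: real \<Rightarrow> real)"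
    by (rule integrable_real_indicator) (cases "0 \<le> lo"; simp)+
  have int: "integrable lborel (\<lambda>s. indicator {0..} s * g s)"
  proof (rule Bochner_Integration.integrable_bound[OF int_hi])
    show "AE s in lborel. norm (indicator {0..} s * g s) \<le> norm (indicator {0..hi} s :: real)"
      using upper g01 by (auto simp: abs_mult)
  qed measurable
  have phi: "phi_positive tr \<alpha> T = (\<integral>s. indicator {0..} s * g s \<partial>lborel)"
    by (simp add: phi_positive_def set_lebesgue_integral_def spectral_projection_eq g_def d_def)
  have "phi_positive tr \<alpha> T \<le> (\<integral>s. indicator {0..hi} s \<partial>lborel)"
    unfolding phi by (intro integral_mono int int_hi upper)
  then show "phi_positive tr \<alpha> T \<le> hi"
    using \<open>0 \<le> hi\<close> by simp
  have "(\<integral>s. indicator {0..<lo} s \<partial>lborel) \<le> phi_positive tr \<alpha> T"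
    unfolding phi by (intro integral_mono int int_lo lower)
  \<comment> \<open>For negative \<open>lo\<close> the interval is empty, and the bound follows from
    nonnegativity of the integral.\<close>
  then show "lo \<le> phi_positive tr \<alpha> T"
    by (cases "0 \<le> lo") (simp_all add: measure_def)
qed

end

text \<open>Supplies a witness for the choice of the translation constant in
  \<open>phi\<close>.\<close>

lemma symmetric_op_add_norm_positive:
  assumes "symmetric_op b"
  shows "positive_op (b + norm b *\<^sub>R id_blinfun)"
proof -
  have "0 \<le> Re (cinner (b v) v) + norm b * (norm v)\<^sup>2" for v
  proof -
    have "- Re (cinner (b v) v) \<le> norm (- b v) * norm v"
      using Re_cinner_le_norm[of "- b v" v] cinner_diff_left[of 0 "b v" v] by simp
    also have "\<dots> \<le> (norm b * norm v) * norm v"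
      using norm_blinfun[of b v] by (simp add: mult_right_mono)
    finally show ?thesis by (simp add: power2_eq_square mult.assoc)
  qed
  then show ?thesis
    using symmetric_op_Im[OF assms]
    by (simp add: positive_op_def blinfun.add_left blinfun.scaleR_left cinner_add_left
        cinner_scaleR_left cinner_self flip: of_real_power)
qed

text \<open>Whatever constant \<open>c\<close> is chosen, the eigenvalues of \<open>b + c\<close>
  lie within \<open>norm b\<close> of \<open>c\<close>, hence so does the value of
  \<open>phi_positive\<close>; \<open>phi\<close> subtracts \<open>c\<close> again.\<close>

lemma abs_phi_le_norm:
  fixes b :: "'h::chilbert_space \<Rightarrow>\<^sub>L 'h"
  assumes tr: "normalized_trace M tr"
    and mono: "mono_on {0..1} \<alpha>" and \<alpha>01: "\<alpha> 0 = 0" "\<alpha> 1 = 1"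
    and b: "symmetric_op b" "p \<noteq> 0" "op_poly p b = 0"
    and M: "\<And>q. op_poly q b \<in> M"
    and w: "(w::'h) \<noteq> 0"
  shows "\<bar>phi tr \<alpha> b\<bar> \<le> norm b"
proof -
  define c where "c = (SOME c. positive_op (b + c *\<^sub>R id_blinfun))"
  have c: "positive_op (b + c *\<^sub>R id_blinfun)"
    unfolding c_def by (rule someI) (rule symmetric_op_add_norm_positive[OF b(1)])
  obtain \<Lambda> P where "finite_spectral_resolution b \<Lambda> P"
    and P: "\<And>x. x \<in> \<Lambda> \<Longrightarrow> \<exists>q. P x = op_poly q b"
    using symmetric_op_finite_spectral_resolution[OF b] by blast
  then interpret b: finite_spectral_resolution b \<Lambda> P by blast
  interpret T: finite_spectral_resolution
    "b + c *\<^sub>R id_blinfun" "(\<lambda>x. x + c) ` \<Lambda>" "\<lambda>x. P (x - c)"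
    by (rule b.shift)
  \<comment> \<open>The trace is constrained only on \<open>M\<close>, so the spectral projections
    must be shown to lie there; they are polynomials in \<open>b\<close>.\<close>
  have sum_M: "\<exists>q. (\<Sum>x\<in>I. P (x - c)) = op_poly q b" if "finite I" "I \<subseteq> (\<lambda>x. x + c) ` \<Lambda>" for I
    using that
  proof (induction I rule: finite_induct)
    case empty
    have "op_poly 0 b = 0" by simp
    then show ?case by (metis sum.empty)
  next
    case (insert x I)
    then obtain q where q: "(\<Sum>x\<in>I. P (x - c)) = op_poly q b" by auto
    obtain r where r: "P (x - c) = op_poly r b" using insert.prems P by force
    have "(\<Sum>x\<in>insert x I. P (x - c)) = op_poly (r + q) b"
      using insert.hyps
      by (intro blinfun_eqI) (simp add: q r blinfun.add_left op_poly_add_apply)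
    then show ?case ..
  qed
  have projM: "T.proj B \<in> M" for B
    using sum_M[of "(\<lambda>x. x + c) ` \<Lambda> \<inter> B"] b.finite_spectrum M by (auto simp: T.proj_def)
  \<comment> \<open>Testing positivity of \<open>b + c\<close> on the nonzero vector
    \<open>w\<close> makes the upper endpoint \<open>c + norm b\<close> nonnegative, as the upper
    bound on the integral requires.\<close>
  have "0 \<le> Re (cinner (b w) w) + c * (norm w)\<^sup>2"
    using c by (simp add: positive_op_def blinfun.add_left blinfun.scaleR_left cinner_add_left
        cinner_scaleR_left cinner_self flip: of_real_power)
  also have "Re (cinner (b w) w) \<le> norm b * norm w * norm w"
    using Re_cinner_le_norm[of "b w" w] norm_blinfun[of b w]
    by (meson mult_right_mono norm_ge_zero order_trans)
  finally have "0 \<le> (norm b + c) * (norm w)\<^sup>2"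
    by (simp add: power2_eq_square algebra_simps)
  then have c': "0 \<le> c + norm b"
    using w by (simp add: zero_le_mult_iff)
  have bounds: "c - norm b \<le> x \<and> x \<le> c + norm b" if "x \<in> (\<lambda>x. x + c) ` \<Lambda>" for x
    using that b.abs_eigenvalue_le_norm by fastforce
  show ?thesis
    using T.phi_positive_bounds[OF tr projM mono \<alpha>01 bounds c']
    by (simp add: phi_def Let_def flip: c_def)
qed


section \<open>Algebraic relations among commuting or anticommuting unitaries\<close>

text \<open>Products of distinct \<open>u i\<close> in decreasing order of index, with either sign.
  Including both signs keeps the finite set stable under reordering.\<close>

fun signed_monomials :: "(nat \<Rightarrow> 'a::real_algebra_1) \<Rightarrow> nat \<Rightarrow> 'a set" where
  "signed_monomials u 0 = {1, - 1}"
| "signed_monomials u (Suc n) = signed_monomials u n \<union> (\<lambda>g. u n * g) ` signed_monomials u n"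

lemma finite_signed_monomials: "finite (signed_monomials u n)"
  by (induction n) auto

lemma one_signed_monomials: "1 \<in> signed_monomials u n"
  by (induction n) auto

lemma uminus_signed_monomials: "g \<in> signed_monomials u n \<Longrightarrow> - g \<in> signed_monomials u n"
proof (induction n arbitrary: g)
  case (Suc n)
  have "- (u n * h) \<in> signed_monomials u (Suc n)" if "h \<in> signed_monomials u n" for h
    using imageI[OF Suc.IH[OF that], of "(*) (u n)"] by simp
  then show ?case
    using Suc by auto
qed auto

text \<open>The factor \<open>u i\<close> either cancels a leading \<open>u n\<close> with
  \<open>i = n\<close>, or moves past it at the cost of a sign and is absorbed by induction.\<close>

lemma mult_signed_monomials:
  assumes sq: "\<And>i. u i * u i = 1"
    and comm: "\<And>i j. u i * u j = u j * u i \<or> u i * u j = - (u j * u i)"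
  shows "i < n \<Longrightarrow> g \<in> signed_monomials u n \<Longrightarrow> u i * g \<in> signed_monomials u n"
proof (induction n arbitrary: g)
  case (Suc n)
  consider "g \<in> signed_monomials u n" | h where "g = u n * h" "h \<in> signed_monomials u n"
    using Suc.prems(2) by auto
  then show ?case
  proof cases
    case 1
    then show ?thesis using Suc by (cases "i = n") auto
  next
    case h: 2
    show ?thesis
    proof (cases "i = n")
      case True
      then have "u i * g = h"
        by (simp add: h(1) sq flip: mult.assoc)
      then show ?thesis using h(2) by simp
    next
      case False
      then have "u i * h \<in> signed_monomials u n"
        using Suc h(2) by auto
      then have "- (u i * h) \<in> signed_monomials u n"
        by (rule uminus_signed_monomials)
      have "u i * g = (u i * u n) * h"
        by (simp add: h(1) mult.assoc)
      from comm[of i n] obtain k where "k \<in> signed_monomials u n" "u i * g = u n * k"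
      proof
        assume "u i * u n = u n * u i"
        then have "u i * g = u n * (u i * h)"
          by (simp add: \<open>u i * g = (u i * u n) * h\<close> mult.assoc)
        then show ?thesis using that \<open>u i * h \<in> signed_monomials u n\<close> by blast
      next
        assume "u i * u n = - (u n * u i)"
        then have "u i * g = u n * (- (u i * h))"
          by (simp add: \<open>u i * g = (u i * u n) * h\<close> mult.assoc)
        then show ?thesis using that \<open>- (u i * h) \<in> signed_monomials u n\<close> by blast
      qed
      then show ?thesis by simp
    qed
  qed
qed simp

lemma power_in_span_invariant:
  fixes y :: "'a::real_algebra_1"
  assumes "1 \<in> span G" "\<And>g. g \<in> G \<Longrightarrow> y * g \<in> span G"
  shows "y ^ i \<in> span G"
proof (induction i)
  case (Suc i)
  have "y * x \<in> span G" if "x \<in> span G" for x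
    using that
  proof (induction rule: span_induct_alt)
    case (step c x z)
    then show ?case
      using assms(2) by (simp add: distrib_left span_add span_scale)
  qed (simp add: span_zero)
  then show ?case using Suc by simp
qed (simp add: assms(1))

text \<open>Among \<open>card G + 1\<close> vectors in the span of \<open>G\<close> either two
  coincide or the vectors are dependent.\<close>

lemma finite_span_sequence_relation:
  fixes f :: "nat \<Rightarrow> 'a::real_vector"
  assumes "finite G" "\<And>i. f i \<in> span G"
  shows "\<exists>a N. (\<exists>i\<le>N. a i \<noteq> 0) \<and> (\<Sum>i\<le>N. a i *\<^sub>R f i) = 0"
proof (cases "inj_on f {..card G}")
  case True
  have "dependent (f ` {..card G})"
  proof (rule ccontr)
    assume "independent (f ` {..card G})"
    then have "card (f ` {..card G}) \<le> card G"
      using independent_span_bound[OF assms(1)] assms(2) by blast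
    then show False using True by (simp add: card_image)
  qed
  then obtain c where c: "\<exists>v\<in>f ` {..card G}. c v \<noteq> 0" "(\<Sum>v\<in>f ` {..card G}. c v *\<^sub>R v) = 0"
    using dependent_finite[of "f ` {..card G}"] by auto
  then show ?thesis
    using True by (intro exI[of _ "c \<circ> f"] exI[of _ "card G"]) (simp add: sum.reindex Bex_def)
next
  case False
  \<comment> \<open>Linear dependence speaks of sets and cannot see repetitions, so two equal terms
    are subtracted directly.\<close>
  then obtain i j where ij: "i \<le> card G" "j \<le> card G" "i \<noteq> j" "f i = f j"
    by (auto simp: inj_on_def)
  define a :: "nat \<Rightarrow> real" where "a k = (if k = i then 1 else if k = j then - 1 else 0)" for k
  have a_i: "a i \<noteq> 0"
    by (simp add: a_def)
  have "(\<Sum>k\<le>card G. a k *\<^sub>R f k) = (\<Sum>k\<in>{i, j}. a k *\<^sub>R f k)"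
    using ij by (intro sum.mono_neutral_right) (auto simp: a_def)
  also have "\<dots> = 0"
    using ij by (simp add: a_def)
  finally show ?thesis
    using ij(1) a_i by blast
qed

text \<open>The cross terms cancel in pairs, and each diagonal term contributes 1.\<close>

lemma sum_anticommuting_squared:
  fixes u :: "'i \<Rightarrow> 'a::real_algebra_1"
  assumes "finite I" "\<And>i. i \<in> I \<Longrightarrow> u i * u i = 1"
    and "\<And>i j. i \<in> I \<Longrightarrow> j \<in> I \<Longrightarrow> i \<noteq> j \<Longrightarrow> u i * u j = - (u j * u i)"
  shows "sum u I * sum u I = of_nat (card I)"
  using assms
proof (induction I rule: finite_induct)
  case empty
  show ?case by simp
next
  case (insert i I)
  have "u i * sum u I = - (sum u I * u i)"
    unfolding sum_distrib_left sum_distrib_right sum_negf[symmetric]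
    using insert.hyps(2) by (intro sum.cong refl insert.prems(2)) auto
  moreover have "sum u (insert i I) * sum u (insert i I)
      = u i * u i + (u i * sum u I + sum u I * u i) + sum u I * sum u I"
    using insert.hyps by (simp add: distrib_left distrib_right add.assoc)
  moreover have "u i * u i = 1"
    by (rule insert.prems(1)) simp
  moreover have "sum u I * sum u I = of_nat (card I)"
    by (intro insert.IH insert.prems) auto
  ultimately show ?case
    using insert.hyps by simp
qed

section \<open>The GNS representation\<close>

lemma star_zero [simp]: "star (0::'a::cstar_algebra) = 0"
  using star_add[of "0::'a" 0] by simp

lemma star_sum: "star (\<Sum>i\<in>I. f i :: 'a::cstar_algebra) = (\<Sum>i\<in>I. star (f i))"
  by (induction I rule: infinite_finite_induct) (simp_all add: star_add)

lemma star_scaleR: "star (r *\<^sub>R x) = r *\<^sub>R star (x::'a::cstar_algebra)"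
  using star_scaleC[of "of_real r" x] by (simp add: scaleC_of_real)

lemma star_one [simp]: "star (1::'a::cstar_algebra) = 1"
  by (metis star_mult star_star mult_1 mult_1_right)

lemma star_power: "star (x ^ n) = star (x::'a::cstar_algebra) ^ n"
  by (induction n) (simp_all add: star_mult power_commutes)

context
  fixes \<tau> :: "'a::cstar_algebra \<Rightarrow> complex" and \<pi> :: "'a \<Rightarrow> 'h::chilbert_space \<Rightarrow>\<^sub>L 'h" and \<xi> :: 'h
  assumes gns: "gns_representation \<tau> \<pi> \<xi>"
begin

lemma gns_add: "\<pi> (x + y) = \<pi> x + \<pi> y"
  using gns by (simp add: gns_representation_def)

lemma gns_mult: "\<pi> (x * y) v = \<pi> x (\<pi> y v)"
  using gns by (simp add: gns_representation_def)

lemma gns_one: "\<pi> 1 = id_blinfun"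
  using gns by (simp add: gns_representation_def)

lemma gns_scaleR: "\<pi> (r *\<^sub>R x) = r *\<^sub>R \<pi> x"
proof (rule blinfun_eqI)
  fix v
  have "\<pi> (scaleC (of_real r) x) v = scaleC (of_real r) (\<pi> x v)"
    using gns by (simp add: gns_representation_def)
  then show "\<pi> (r *\<^sub>R x) v = (r *\<^sub>R \<pi> x) v"
    by (simp add: scaleC_of_real blinfun.scaleR_left)
qed

lemma gns_zero: "\<pi> 0 = 0"
  using gns_scaleR[of 0 0] by simp

lemma gns_sum: "\<pi> (\<Sum>i\<in>I. f i) = (\<Sum>i\<in>I. \<pi> (f i))"
  by (induction I rule: infinite_finite_induct) (simp_all add: gns_add gns_zero)

lemma gns_symmetric: "star x = x \<Longrightarrow> symmetric_op (\<pi> x)"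
  using gns unfolding gns_representation_def symmetric_op_def by metis

lemma gns_op_poly: "op_poly q (\<pi> x) \<in> range \<pi>"
proof (induction q)
  case 0
  then show ?case by (metis op_poly_0 gns_zero rangeI)
next
  case (pCons c q)
  then obtain y where y: "op_poly q (\<pi> x) = \<pi> y" by auto
  have "op_poly (pCons c q) (\<pi> x) = \<pi> (c *\<^sub>R 1 + x * y)"
    by (intro blinfun_eqI)
      (simp add: op_poly_pCons_apply y gns_add gns_scaleR gns_one gns_mult blinfun.add_left
        blinfun.scaleR_left)
  then show ?case by simp
qed

lemma gns_op_poly_monom: "op_poly (monom c n) (\<pi> x) v = c *\<^sub>R \<pi> (x ^ n) v"
  by (induction n)
    (simp_all add: monom_0 monom_Suc op_poly_pCons_apply gns_one gns_mult blinfun.zero_left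
      blinfun.zero_right blinfun.scaleR_right)

text \<open>A linear relation among the powers of \<open>x\<close> becomes an annihilating
  polynomial of \<open>\<pi> x\<close>, nonzero because its coefficient \<open>a i\<close>
  is.\<close>

lemma gns_op_poly_relation:
  assumes "i \<le> N" "a i \<noteq> 0" "(\<Sum>i\<le>N. a i *\<^sub>R x ^ i) = 0"
  shows "\<exists>p. p \<noteq> 0 \<and> op_poly p (\<pi> x) = 0"
proof (intro exI conjI)
  let ?p = "\<Sum>i\<le>N. monom (a i) i"
  have "coeff ?p i = (\<Sum>j\<le>N. if j = i then a i else 0)"
    unfolding coeff_sum by (intro sum.cong) auto
  then have "coeff ?p i \<noteq> 0"
    using assms(1,2) by simp
  then show "?p \<noteq> 0" by force
  show "op_poly ?p (\<pi> x) = 0"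
  proof (rule blinfun_eqI)
    fix v
    have "op_poly ?p (\<pi> x) v = \<pi> (\<Sum>i\<le>N. a i *\<^sub>R x ^ i) v"
      by (simp add: op_poly_sum_apply gns_op_poly_monom gns_sum gns_scaleR blinfun.sum_left
          blinfun.scaleR_left)
    then show "op_poly ?p (\<pi> x) v = blinfun_apply 0 v"
      by (simp only: assms(3) gns_zero)
  qed
qed

lemma gns_norm_power_le: "norm (\<pi> (x ^ n)) \<le> norm (\<pi> x) ^ n"
proof (induction n)
  case 0
  then show ?case
    by (simp add: gns_one norm_blinfun_id_le)
next
  case (Suc n)
  have "norm (\<pi> (x * x ^ n)) \<le> norm (\<pi> x) * norm (\<pi> (x ^ n))"
    using norm_blinfun_compose[of "\<pi> x" "\<pi> (x ^ n)"] gns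
    by (simp add: gns_representation_def)
  also have "\<dots> \<le> norm (\<pi> x) * norm (\<pi> x) ^ n"
    by (intro mult_left_mono Suc.IH) simp
  finally show ?case by simp
qed

text \<open>By symmetry the squared norm of \<open>\<pi> x v\<close> is the pairing of
  \<open>\<pi> (x * x) v\<close> with \<open>v\<close>, that is, \<open>m\<close> times the squared
  norm of \<open>v\<close>.\<close>

lemma gns_norm_square:
  assumes "star x = x" "x * x = of_nat m"
  shows "norm (\<pi> x) \<le> sqrt m"
proof (rule norm_blinfun_bound)
  fix v
  have "\<pi> (of_nat m) v = real m *\<^sub>R v"
  proof -
    have "of_nat m = real m *\<^sub>R (1::'a)"
      by (simp add: scaleR_conv_of_real)
    then show ?thesis
      by (simp only: gns_scaleR gns_one blinfun.scaleR_left blinfun_apply_id_blinfun)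
  qed
  then have "\<pi> x (\<pi> x v) = real m *\<^sub>R v"
    using gns_mult[of x x v] by (simp add: assms(2))
  then have "complex_of_real ((norm (\<pi> x v))\<^sup>2) = cinner (real m *\<^sub>R v) v"
    by (simp add: norm_symmetric_op_power2[OF gns_symmetric[OF assms(1)], symmetric]
        del: of_real_power)
  also have "\<dots> = of_real (real m * (norm v)\<^sup>2)"
    by (simp add: cinner_scaleR_left cinner_self)
  finally have "complex_of_real ((norm (\<pi> x v))\<^sup>2) = of_real (real m * (norm v)\<^sup>2)" .
  then have "(norm (\<pi> x v))\<^sup>2 = real m * (norm v)\<^sup>2"
    by (simp only: of_real_eq_iff)
  then have "norm (\<pi> x v) = sqrt (real m * (norm v)\<^sup>2)"
    by (metis norm_ge_zero real_sqrt_unique)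
  then show "norm (\<pi> x v) \<le> sqrt m * norm v"
    by (simp add: real_sqrt_mult)
qed simp

lemma range_gns_subset: "range \<pi> \<subseteq> gns_von_neumann_algebra \<pi>"
  unfolding gns_von_neumann_algebra_def
  by (intro closure_of_subset) (simp add: weak_operator_topology_def topspace_pullback_topology)

text \<open>Each residue class sum squares to its cardinality, at most \<open>n\<close>; the
  triangle inequality over the \<open>K\<close> classes gives the bound.\<close>

lemma gns_norm_sum_le:
  fixes u :: "nat \<Rightarrow> 'a"
  assumes u: "\<And>i. self_adjoint_unitary (u i)" and "K \<ge> 1"
    and anti: "\<And>i j. i \<noteq> j \<Longrightarrow> i mod K = j mod K \<Longrightarrow> u i * u j = - (u j * u i)"
  shows "norm (\<pi> (\<Sum>i<n. u i)) \<le> real K * sqrt (real n)"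
proof -
  define I where "I r = {i. i < n \<and> i mod K = r}" for r
  have fin: "finite (I r)" for r by (simp add: I_def)
  have star_u: "star (u i) = u i" and u_sq: "u i * u i = 1" for i
    using u[of i] by (auto simp: self_adjoint_unitary_def)
  have "norm (\<pi> (sum u (I r))) \<le> sqrt (real n)" for r
  proof -
    have "sum u (I r) * sum u (I r) = of_nat (card (I r))"
      by (rule sum_anticommuting_squared[OF fin u_sq anti]) (auto simp: I_def)
    then have "norm (\<pi> (sum u (I r))) \<le> sqrt (card (I r))"
      by (intro gns_norm_square) (simp_all add: star_sum star_u)
    also have "card (I r) \<le> card {..<n}"
      by (intro card_mono) (auto simp: I_def)
    finally show ?thesis by simp
  qed
  moreover have "\<pi> (\<Sum>i<n. u i) = (\<Sum>r<K. \<pi> (sum u (I r)))"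
  proof -
    have "(\<Sum>i<n. u i) = (\<Sum>r<K. \<Sum>i | i \<in> {..<n} \<and> i mod K = r. u i)"
      using \<open>K \<ge> 1\<close> by (intro sum.group[symmetric]) auto
    then show ?thesis by (simp add: gns_sum I_def)
  qed
  ultimately show ?thesis
    using sum_norm_le[of "{..<K}" "\<lambda>r. \<pi> (sum u (I r))" "\<lambda>_. sqrt (real n)"] by simp
qed

end

text \<open>Left multiplication by \<open>y\<close> preserves the span of the finitely many signed
  monomials. The powers of \<open>y ^ k\<close> lie in that span and so satisfy a linear relation,
  which yields the annihilating polynomial needed for the estimate of \<open>phi\<close>.\<close>

lemma abs_phi_gns_le_norm:
  fixes u :: "nat \<Rightarrow> 'a::cstar_algebra" and \<pi> :: "'a \<Rightarrow> 'h::chilbert_space \<Rightarrow>\<^sub>L 'h"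
  assumes \<tau>: "tracial_state \<tau>" and gns: "gns_representation \<tau> \<pi> \<xi>"
    and tr: "normalized_trace (gns_von_neumann_algebra \<pi>) tr"
    and mono: "mono_on {0..1} \<alpha>" and \<alpha>01: "\<alpha> 0 = 0" "\<alpha> 1 = 1"
    and u: "\<And>i. self_adjoint_unitary (u i)"
    and comm: "\<And>i j. u i * u j = u j * u i \<or> u i * u j = - (u j * u i)"
  shows "\<bar>phi tr \<alpha> (\<pi> ((c *\<^sub>R (\<Sum>i<n. u i)) ^ k))\<bar> \<le> norm (\<pi> ((c *\<^sub>R (\<Sum>i<n. u i)) ^ k))"
proof -
  let ?G = "signed_monomials u n"
  define y where "y = c *\<^sub>R (\<Sum>i<n. u i)"
  have star_u: "star (u i) = u i" and u_sq: "u i * u i = 1" for i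
    using u[of i] by (auto simp: self_adjoint_unitary_def)
  have "y * g \<in> span ?G" if "g \<in> ?G" for g
    unfolding y_def sum_distrib_right mult_scaleR_left
    using mult_signed_monomials[of u, OF u_sq comm _ that]
    by (intro span_scale span_sum span_base) auto
  then have "y ^ i \<in> span ?G" for i
    by (rule power_in_span_invariant[OF span_base[OF one_signed_monomials]])
  then have "(y ^ k) ^ i \<in> span ?G" for i
    by (metis power_mult)
  then obtain a N i where "i \<le> N" "a i \<noteq> 0" "(\<Sum>i\<le>N. a i *\<^sub>R (y ^ k) ^ i) = 0"
    using finite_span_sequence_relation[OF finite_signed_monomials] by blast
  then obtain p where p: "p \<noteq> 0" "op_poly p (\<pi> (y ^ k)) = 0"
    using gns_op_poly_relation[OF gns] by blast
  have "star (y ^ k) = y ^ k"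
    by (simp add: y_def star_power star_scaleR star_sum star_u)
  then have sym: "symmetric_op (\<pi> (y ^ k))"
    by (rule gns_symmetric[OF gns])
  \<comment> \<open>The normalization of the trace makes \<xi> the required nonzero vector.\<close>
  have "cinner (\<pi> 1 \<xi>) \<xi> = 1"
    using gns \<tau> by (simp add: gns_representation_def tracial_state_def)
  then have "\<xi> \<noteq> 0" by auto
  have "op_poly q (\<pi> (y ^ k)) \<in> gns_von_neumann_algebra \<pi>" for q
    using gns_op_poly[OF gns] range_gns_subset[OF gns] by blast
  from abs_phi_le_norm[OF tr mono \<alpha>01 sym p this \<open>\<xi> \<noteq> 0\<close>] show ?thesis
    by (simp add: y_def)
qed

theorem mainTheorem4:
  fixes \<iota> :: "nat \<Rightarrow> complex^2^2 \<Rightarrow> 'a::cstar_algebra"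
    and \<tau> :: "'a \<Rightarrow> complex"
    and \<pi> :: "'a \<Rightarrow> 'h::chilbert_space \<Rightarrow>\<^sub>L 'h" and \<xi> :: 'h
    and tr :: "('h \<Rightarrow>\<^sub>L 'h) \<Rightarrow> complex"
    and u :: "nat \<Rightarrow> 'a" and a :: "nat \<Rightarrow> nat" and K k :: nat
    and \<alpha> :: "real \<Rightarrow> real"
  assumes "infinite_tensor_M2 \<iota>"
    and "tracial_state \<tau>"
    and "gns_representation \<tau> \<pi> \<xi>"
    and "normalized_trace (gns_von_neumann_algebra \<pi>) tr"
    and "\<And>n. self_adjoint_unitary (u n)"
    and "\<And>n. a n \<in> {0, 1}" and "a 0 = 0"
    and "\<And>i j. u i * u j = (-1) ^ a (nat \<bar>int i - int j\<bar>) * (u j * u i)"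
    and "K \<ge> 1" and "\<And>l. l \<ge> 1 \<Longrightarrow> a (K * l) = 1"
    and "k \<ge> 1"
    and "mono_on {0..1} \<alpha>" and "continuous_on {0..1} \<alpha>" and "\<alpha> ` {0..1} \<subseteq> {0..1}"
    and "\<alpha> 0 = 0" and "\<alpha> 1 = 1"
  shows "(\<lambda>n. norm (\<pi> ((\<Sum>i<n. u i) /\<^sub>R real n))) \<longlonglongrightarrow> 0
    \<and> (\<lambda>n. norm (\<pi> (((\<Sum>i<n. u i) /\<^sub>R real n) ^ k))) \<longlonglongrightarrow> 0
    \<and> (\<lambda>n. phi tr \<alpha> (\<pi> (((\<Sum>i<n. u i) /\<^sub>R real n) ^ k))) \<longlonglongrightarrow> 0"
proof -
  note gns = assms(3) and u = assms(5) and rel = assms(8)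
  have comm: "u i * u j = u j * u i \<or> u i * u j = - (u j * u i)" for i j
    using rel[of i j] assms(6)[of "nat \<bar>int i - int j\<bar>"] by auto
  have anti: "u i * u j = - (u j * u i)" if "i \<noteq> j" "i mod K = j mod K" for i j
  proof -
    \<comment> \<open>Distinct indices in one class differ by a nonzero multiple of
      \<open>K\<close>, where the exponent \<open>a\<close> equals 1.\<close>
    have "int K dvd int i - int j"
      using that(2) by (metis mod_eq_dvd_iff zmod_int)
    then obtain l where l: "int i - int j = int K * l" by (auto elim: dvdE)
    then have "nat \<bar>int i - int j\<bar> = K * nat \<bar>l\<bar>"
      by (simp add: abs_mult nat_mult_distrib)
    moreover have "nat \<bar>l\<bar> \<ge> 1"
      using l that(1) by (cases "l = 0") auto
    ultimately show ?thesis
      using rel[of i j] assms(10)[of "nat \<bar>l\<bar>"] by simp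
  qed
  have bound: "norm (\<pi> ((\<Sum>i<n. u i) /\<^sub>R real n)) \<le> real K * inverse (sqrt (real n))" for n
  proof -
    have "norm (\<pi> ((\<Sum>i<n. u i) /\<^sub>R real n)) \<le> inverse (real n) * (real K * sqrt (real n))"
      unfolding gns_scaleR[OF gns]
      using gns_norm_sum_le[OF gns u \<open>K \<ge> 1\<close> anti] by (simp add: mult_left_mono)
    \<comment> \<open>At \<open>n = 0\<close> both sides are 0, since
      \<open>inverse 0 = 0\<close>.\<close>
    also have "\<dots> = real K * inverse (sqrt (real n))"
      by (cases "n = 0") (simp_all add: field_simps)
    finally show ?thesis .
  qed
  have "(\<lambda>n. real K * inverse (sqrt (real n))) \<longlonglongrightarrow> real K * 0"
    by (intro tendsto_mult tendsto_const tendsto_inverse_0_at_top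
        filterlim_compose[OF sqrt_at_top filterlim_real_sequentially])
  then have "(\<lambda>n. real K * inverse (sqrt (real n))) \<longlonglongrightarrow> 0"
    by simp
  then have 1: "(\<lambda>n. norm (\<pi> ((\<Sum>i<n. u i) /\<^sub>R real n))) \<longlonglongrightarrow> 0"
    by (rule Lim_null_comparison[OF always_eventually, rotated])
      (simp only: real_norm_def abs_norm_cancel bound simp_thms)
  have "(\<lambda>n. norm (\<pi> ((\<Sum>i<n. u i) /\<^sub>R real n)) ^ k) \<longlonglongrightarrow> 0 ^ k"
    by (rule tendsto_power[OF 1])
  moreover have "(0::real) ^ k = 0"
    using \<open>k \<ge> 1\<close> by simp
  ultimately have "(\<lambda>n. norm (\<pi> ((\<Sum>i<n. u i) /\<^sub>R real n)) ^ k) \<longlonglongrightarrow> 0"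
    by (simp only:)
  then have 2: "(\<lambda>n. norm (\<pi> (((\<Sum>i<n. u i) /\<^sub>R real n) ^ k))) \<longlonglongrightarrow> 0"
    by (rule Lim_null_comparison[OF always_eventually, rotated])
      (simp only: real_norm_def abs_norm_cancel gns_norm_power_le[OF gns] simp_thms)
  have 3: "(\<lambda>n. phi tr \<alpha> (\<pi> (((\<Sum>i<n. u i) /\<^sub>R real n) ^ k))) \<longlonglongrightarrow> 0"
    by (rule Lim_null_comparison[OF always_eventually 2])
      (simp only: real_norm_def abs_phi_gns_le_norm[OF assms(2-4,12,15,16) u comm] simp_thms)
  show ?thesis using 1 2 3 by blast
qed

end
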